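(* Let $J$ be any 2-connected cubic graph, and let $C$ be a separating cut of a matching covered graph $G$. If $G$ is $K_4(J)$-free, then both $C$-contractions of $G$ are $K_4(J)$-free.
   Context: Graphs are finite and loopless; multiple edges are allowed. A graph is matchable if it has a perfect matching (the empty graph is matchable). A connected graph with at least two vertices is matching covered if each edge lies in some perfect matching. A graph is cubic if every vertex has degree three. The graph $\Theta$ (two vertices joined by three edges) counts as 2-connected; every 2-connected cubic graph is matching covered. For $X\subseteq V(G)$, $\partial(X)$ is the set of edges with exactly one end in $X$, and $\overline{X}=V(G)-X$. $G/X$ denotes the graph obtained by shrinking $X$ to a single vertex and deleting all edges with both ends in $X$. For a cut $C=\partial(X)$, the graphs $G/X$ and $G/\overline{X}$ are the $C$-contractions of $G$. A cut $C$ of a matching covered graph $G$ is separating if both $C$-contractions are matching covered. A subgraph $H$ of $G$ is conformal if $G-V(H)$ is matchable. A bi-subdivision of a graph $L$ is a graph obtained from $L$ by subdividing each edge of some subset of $E(L)$ with an even number of subdivision vertices. A matching covered graph $L$ is a conformal minor of a matching covered graph $G$ if $G$ has a conformal subgraph that is a bi-subdivision of $L$. For a finite set $\mathcal{J}$ of matching covered graphs, $G$ is $\mathcal{J}$-free if no member of $\mathcal{J}$ is a conformal minor of $G$. For a 2-connected cubic graph $J$ and $T\subseteq V(J)$ (possibly empty or all of $V(J)$), $J^T\odot K_4$ is the cubic graph obtained from $J$ by replacing each vertex $v\in T$ by a triangle, the three edges of $J$ incident with $v$ becoming incident with the three distinct vertices of the triangle. $K_4(J)=\{J^T\odot K_4: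 T\subseteq V(J)\}$ (up to isomorphism). *)

theory Defs
  imports Main
begin

text \<open>Undirected multigraphs: edges are abstract objects, each mapped to the set of its ends, so
  that parallel edges are distinct edges with the same ends.\<close>

record ('v, 'e) mgraph =
  verts :: "'v set"
  edges :: "'e set"
  ends :: "'e \<Rightarrow> 'v set"

text \<open>Requiring exactly two ends per edge excludes loops.\<close>

definition graph :: "('v, 'e) mgraph \<Rightarrow> bool" where
  "graph G \<longleftrightarrow> finite (verts G) \<and> finite (edges G) \<and>
     (\<forall>e \<in> edges G. ends G e \<subseteq> verts G \<and> card (ends G e) = 2)"

definition degree :: "('v, 'e) mgraph \<Rightarrow> 'v \<Rightarrow> nat" where
  "degree G v = card {e \<in> edges G. v \<in> ends G e}"

definition cubic :: "('v, 'e) mgraph \<Rightarrow> bool" where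
  "cubic G \<longleftrightarrow> (\<forall>v \<in> verts G. degree G v = 3)"

definition adj :: "('v, 'e) mgraph \<Rightarrow> ('v \<times> 'v) set" where
  "adj G = {(u, v). \<exists>e \<in> edges G. ends G e = {u, v}}"

definition connected_graph :: "('v, 'e) mgraph \<Rightarrow> bool" where
  "connected_graph G \<longleftrightarrow> verts G \<noteq> {} \<and> (\<forall>u \<in> verts G. \<forall>v \<in> verts G. (u, v) \<in> (adj G)\<^sup>*)"

definition delete_verts :: "('v, 'e) mgraph \<Rightarrow> 'v set \<Rightarrow> ('v, 'e) mgraph" where
  "delete_verts G X =
     \<lparr>verts = verts G - X, edges = {e \<in> edges G. ends G e \<inter> X = {}}, ends = ends G\<rparr>"

text \<open>Only two (rather than three) vertices are demanded, so that the graph with two vertices and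
  three parallel edges counts as 2-connected.\<close>

definition two_connected :: "('v, 'e) mgraph \<Rightarrow> bool" where
  "two_connected G \<longleftrightarrow> card (verts G) \<ge> 2 \<and> connected_graph G \<and>
     (\<forall>v \<in> verts G. connected_graph (delete_verts G {v}))"

definition perfect_matching :: "('v, 'e) mgraph \<Rightarrow> 'e set \<Rightarrow> bool" where
  "perfect_matching G M \<longleftrightarrow> M \<subseteq> edges G \<and> (\<forall>v \<in> verts G. \<exists>!e. e \<in> M \<and> v \<in> ends G e)"

definition matchable :: "('v, 'e) mgraph \<Rightarrow> bool" where
  "matchable G \<longleftrightarrow> (\<exists>M. perfect_matching G M)"

definition matching_covered :: "('v, 'e) mgraph \<Rightarrow> bool" where
  "matching_covered G \<longleftrightarrow> connected_graph G \<and> card (verts G) \<ge> 2 \<and>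
     (\<forall>e \<in> edges G. \<exists>M. perfect_matching G M \<and> e \<in> M)"

definition boundary :: "('v, 'e) mgraph \<Rightarrow> 'v set \<Rightarrow> 'e set" where
  "boundary G X = {e \<in> edges G. card (ends G e \<inter> X) = 1}"

text \<open>In \<open>G/X\<close> the vertex \<^term>\<open>None\<close> is the one to which \<open>X\<close> is shrunk.\<close>

definition contract :: "('v, 'e) mgraph \<Rightarrow> 'v set \<Rightarrow> ('v option, 'e) mgraph" where
  "contract G X =
     \<lparr>verts = insert None (Some ` (verts G - X)),
      edges = {e \<in> edges G. \<not> ends G e \<subseteq> X},
      ends = (\<lambda>e. (\<lambda>v. if v \<in> X then None else Some v) ` ends G e)\<rparr>"

definition is_cut :: "('v, 'e) mgraph \<Rightarrow> 'e set \<Rightarrow> bool" where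
  "is_cut G C \<longleftrightarrow> (\<exists>X \<subseteq> verts G. C = boundary G X)"

text \<open>A set and its complement have the same boundary, and in a connected graph no third vertex set
  has that boundary. So for a cut \<open>C\<close> of a connected graph these are precisely the two
  \<open>C\<close>-contractions.\<close>

definition cut_contractions :: "('v, 'e) mgraph \<Rightarrow> 'e set \<Rightarrow> ('v option, 'e) mgraph set" where
  "cut_contractions G C = {contract G X |X. X \<subseteq> verts G \<and> boundary G X = C}"

definition separating_cut :: "('v, 'e) mgraph \<Rightarrow> 'e set \<Rightarrow> bool" where
  "separating_cut G C \<longleftrightarrow> is_cut G C \<and> (\<forall>H \<in> cut_contractions G C. matching_covered H)"

definition subgraph :: "('v, 'e) mgraph \<Rightarrow> ('v, 'e) mgraph \<Rightarrow> bool" where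
  "subgraph H G \<longleftrightarrow> graph H \<and> verts H \<subseteq> verts G \<and> edges H \<subseteq> edges G \<and>
     (\<forall>e \<in> edges H. ends H e = ends G e)"

definition conformal :: "('v, 'e) mgraph \<Rightarrow> ('v, 'e) mgraph \<Rightarrow> bool" where
  "conformal H G \<longleftrightarrow> subgraph H G \<and> matchable (delete_verts G (verts H))"

definition isomorphic :: "('v, 'e) mgraph \<Rightarrow> ('w, 'f) mgraph \<Rightarrow> bool" where
  "isomorphic G H \<longleftrightarrow> (\<exists>f g. bij_betw f (verts G) (verts H) \<and> bij_betw g (edges G) (edges H) \<and>
     (\<forall>e \<in> edges G. ends H (g e) = f ` ends G e))"

text \<open>Here \<open>a e\<close> and \<open>b e\<close> are the two ends of the edge \<open>e\<close> and \<open>s e\<close> is the number of vertices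
  subdividing it. The edge \<open>e\<close> becomes a path from \<open>a e\<close> to \<open>b e\<close> with \<open>s e\<close> internal vertices,
  the vertex at distance \<open>i\<close> from the start being \<open>sub_vertex a b s e i\<close>.\<close>

definition sub_vertex ::
  "('e \<Rightarrow> 'v) \<Rightarrow> ('e \<Rightarrow> 'v) \<Rightarrow> ('e \<Rightarrow> nat) \<Rightarrow> 'e \<Rightarrow> nat \<Rightarrow> 'v + 'e \<times> nat" where
  "sub_vertex a b s e i =
     (if i = 0 then Inl (a e) else if i \<le> s e then Inr (e, i) else Inl (b e))"

definition subdivide :: "('v, 'e) mgraph \<Rightarrow> ('e \<Rightarrow> 'v) \<Rightarrow> ('e \<Rightarrow> 'v) \<Rightarrow> ('e \<Rightarrow> nat) \<Rightarrow>
    ('v + 'e \<times> nat, 'e \<times> nat) mgraph" where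
  "subdivide L a b s =
     \<lparr>verts = Inl ` verts L \<union> {Inr (e, i) |e i. e \<in> edges L \<and> 1 \<le> i \<and> i \<le> s e},
      edges = {(e, i) |e i. e \<in> edges L \<and> i \<le> s e},
      ends = (\<lambda>(e, i). {sub_vertex a b s e i, sub_vertex a b s e (Suc i)})\<rparr>"

definition bisubdivision :: "('v, 'e) mgraph \<Rightarrow> ('w, 'f) mgraph \<Rightarrow> bool" where
  "bisubdivision H L \<longleftrightarrow> (\<exists>a b s. (\<forall>e \<in> edges L. ends L e = {a e, b e} \<and> even (s e)) \<and>
     isomorphic H (subdivide L a b s))"

definition conformal_minor :: "('w, 'f) mgraph \<Rightarrow> ('v, 'e) mgraph \<Rightarrow> bool" where
  "conformal_minor L G \<longleftrightarrow> (\<exists>H. conformal H G \<and> bisubdivision H L)"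

definition minor_free :: "('w, 'f) mgraph set \<Rightarrow> ('v, 'e) mgraph \<Rightarrow> bool" where
  "minor_free \<J> G \<longleftrightarrow> (\<forall>L \<in> \<J>. \<not> conformal_minor L G)"

text \<open>The triangle replacing a vertex \<open>v\<close> in \<open>T\<close> has one vertex \<open>Inr (v, e)\<close> for each edge \<open>e\<close> of
  \<open>J\<close> incident with \<open>v\<close>, to which \<open>e\<close> is then attached. Its three edges are \<open>Inr (v, {e, f})\<close> for
  the pairs of distinct edges \<open>e\<close>, \<open>f\<close> incident with \<open>v\<close>.\<close>

definition splice_vertex :: "'v set \<Rightarrow> 'e \<Rightarrow> 'v \<Rightarrow> 'v + 'v \<times> 'e" where
  "splice_vertex T e v = (if v \<in> T then Inr (v, e) else Inl v)"

definition splice_K4 ::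
  "('v, 'e) mgraph \<Rightarrow> 'v set \<Rightarrow> ('v + 'v \<times> 'e, 'e + 'v \<times> 'e set) mgraph" where
  "splice_K4 J T =
     \<lparr>verts = Inl ` (verts J - T) \<union> {Inr (v, e) |v e. v \<in> T \<and> e \<in> edges J \<and> v \<in> ends J e},
      edges = Inl ` edges J \<union>
        {Inr (v, {e, f}) |v e f. v \<in> T \<and> e \<noteq> f \<and>
           e \<in> edges J \<and> v \<in> ends J e \<and> f \<in> edges J \<and> v \<in> ends J f},
      ends = (\<lambda>x. case x of
          Inl e \<Rightarrow> splice_vertex T e ` ends J e
        | Inr (v, P) \<Rightarrow> (\<lambda>e. Inr (v, e)) ` P)\<rparr>"

definition K4_family ::
  "('v, 'e) mgraph \<Rightarrow> ('v + 'v \<times> 'e, 'e + 'v \<times> 'e set) mgraph set" where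
  "K4_family J = {splice_K4 J T |T. T \<subseteq> verts J}"

end

theory Submission imports Defs begin

text \<open>
  An expansion of \<open>J\<close> in \<open>G\<close> consists of disjoint vertex sets \<open>S v\<close>, one for every vertex \<open>v\<close>
  of \<open>J\<close>, joined by edges of \<open>G\<close> that correspond to those of \<open>J\<close>, such that \<open>S v\<close> minus the end of
  any of the three edges leaving it is matchable, and so is what remains of \<open>G\<close>. A splicing of \<open>J\<close>
  contains an expansion of \<open>J\<close>, a conformal bi-subdivision of \<open>K\<close> gives one of \<open>K\<close>, and \<open>G\<close> contains
  one of \<open>G/X\<close>. Such expansions compose, so a conformal minor of \<open>G/X\<close> in the family yields an expansion of
  \<open>J\<close> in \<open>G\<close>. Conversely, choose an expansion with few vertices and fix three matchings
  of \<open>S v\<close> minus an end. Unless \<open>S v\<close> is a singleton or a triangle, they can be rechosen so that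
  two of them share an edge \<open>uw\<close>; then the third one, or the edge leaving \<open>S v\<close>, passes
  through \<open>u\<close> and \<open>w\<close> on a path with three edges, which can be suppressed to one edge. When only
  singletons and triangles are left, the expansion is a splicing of \<open>J\<close> with copies of \<open>K\<^sub>4\<close>.
\<close>

section \<open>Three matchings on a path\<close>

text \<open>The set \<open>T\<close> cannot be kept fixed. Contracting a triangle of K4 gives Theta,
  yet Theta is not a conformal minor of K4: every bi-subdivision of Theta with at most four vertices
  has parallel edges. Hence a vertex of \<open>J\<close> that is plain in \<open>G/X\<close> may
  have to become a triangle in \<open>G\<close>. An expansion therefore forgets the structure of
  \<open>S v\<close> and keeps only the possibility of leaving out each of the three ends. Unlike
  the presence of suitable paths, this survives composition, and it is exactly what a separating cut
  guarantees for \<open>X\<close>. The structure of \<open>S v\<close> is recovered from its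
  matchings. Leaving out either of two ends gives an alternating path between them; if no edge can
  be shared, this path exhausts \<open>S v\<close> and contains the third end. Parity of positions
  on the path then shows that all edges of the third matching would be nested without a shortest
  one, except on a path of three vertices closed to a triangle. This is why K4 is the only graph
  that has to be spliced in.\<close>

text \<open>When the chord \<open>{k, l}\<close> crosses \<open>{i, j}\<close>, removing
  \<open>i\<close> and \<open>j\<close> leaves five gaps and the pair \<open>{k, l}\<close>. The
  nested union matches the way in which the closure rules for \<open>R\<close> are applied later,
  gap by gap.\<close>

lemma interval_minus_crossing_pair:
  fixes a b i j k l :: nat
  assumes "a \<le> i" "i < k" "k < j" "j < l" "l < b"
  shows "{a..<b} - {i, j} = {a..<i} \<union> ({Suc i..<k} \<union>
    ({Suc k..<j} \<union> ({Suc j..<l} \<union> ({Suc l..<b} \<union> {k, l}))))" (is "?L = ?R")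
proof (rule set_eqI)
  fix x
  consider "x < i" | "x = i" | "i < x" "x < k" | "x = k" | "k < x" "x < j" | "x = j"
    | "j < x" "x < l" | "x = l" | "l < x" by linarith
  then show "x \<in> ?L \<longleftrightarrow> x \<in> ?R"
    using assms by cases simp_all
qed

text \<open>The path \<open>0, \<dots>, K\<close> minus \<open>0\<close>, and the path minus \<open>K\<close>, are matched by path edges, and \<open>third\<close>
  describes the matchings of the path minus \<open>y\<close>. The predicate \<open>R A\<close> says that \<open>A\<close> can be
  matched, and \<open>shared x z\<close> that the complements of \<open>x\<close> and of \<open>z\<close> have matchings with a common
  edge.\<close>

lemma path_three_matchings:
  fixes R :: "nat set \<Rightarrow> bool" and adj :: "nat \<Rightarrow> nat \<Rightarrow> bool" and K y :: nat
  defines "shared x z \<equiv> \<exists>i\<le>K. \<exists>j\<le>K. i \<noteq> j \<and> adj i j \<and> {i, j} \<inter> {x, z} = {} \<and>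
      R ({..K} - {x, i, j}) \<and> R ({..K} - {z, i, j})"
  assumes union: "\<And>A B. R A \<Longrightarrow> R B \<Longrightarrow> A \<inter> B = {} \<Longrightarrow> R (A \<union> B)"
    and interval: "\<And>l r. l \<le> r \<Longrightarrow> r \<le> Suc K \<Longrightarrow> even l = even r \<Longrightarrow> R {l..<r}"
    and pair: "\<And>i j. i < j \<Longrightarrow> j \<le> K \<Longrightarrow> adj i j \<Longrightarrow> R {i, j}"
    and step: "\<And>k. k < K \<Longrightarrow> adj k (Suc k)"
    and sym: "\<And>i j. adj i j \<Longrightarrow> adj j i"
    and third: "\<And>i. i \<le> K \<Longrightarrow> i \<noteq> y \<Longrightarrow>
      \<exists>j\<le>K. j \<noteq> i \<and> j \<noteq> y \<and> adj i j \<and> R ({..K} - {y, i, j})"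
    and K: "even K" "K \<ge> 2" and y: "y \<le> K"
  shows "K = 2 \<and> y = 1 \<and> adj 0 2 \<or> shared 0 y \<or> shared K y"
proof (rule ccontr)
  assume neg: "\<not> ?thesis"
  then have no0y: "\<not> shared 0 y" and noKy: "\<not> shared K y"
    and notri: "\<not> (K = 2 \<and> y = 1 \<and> adj 0 2)" by auto
  have sharedI: "shared x z" if "i < j" "j \<le> K" "adj i j" "{i, j} \<inter> {x, z} = {}"
    "R ({..K} - {x, i, j})" "R ({..K} - {z, i, j})" for i j x z
  proof -
    have "i \<le> K" "i \<noteq> j" using that by auto
    with that show ?thesis unfolding shared_def by blast
  qed
  \<comment> \<open>A chord belongs to some matching that leaves out \<open>y\<close>. No third
    matching is fixed, so two chords may come from different ones; edges of the path are not
    excluded.\<close>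
  define chord where "chord i j \<longleftrightarrow>
    i < j \<and> j \<le> K \<and> i \<noteq> y \<and> j \<noteq> y \<and> adj i j \<and> R ({..K} - {y, i, j})" for i j
  have chord_ex: "\<exists>j. chord i j \<or> chord j i" if i: "i \<le> K" "i \<noteq> y" for i
  proof -
    obtain j where j: "j \<le> K" "j \<noteq> i" "j \<noteq> y" "adj i j" "R ({..K} - {y, i, j})"
      using third[OF i] by blast
    have "{..K} - {y, i, j} = {..K} - {y, j, i}" by auto
    with j i have "chord i j \<or> chord j i"
      unfolding chord_def using sym[OF j(4)] by (metis linorder_neqE_nat)
    then show ?thesis by blast
  qed
  \<comment> \<open>For even \<open>y\<close> the path minus \<open>y\<close> is matched by path
    edges alone, and one of them lies in a path matching that avoids an end. If
    \<open>y = 0\<close>, the goal \<open>shared 0 y\<close> involves only one vertex, so the edge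
    from 1 to 2 suffices.\<close>
  have y_odd: "odd y"
  proof
    assume ev: "even y"
    show False
    proof (cases "y = 0")
      case True
      have a: "{..K} - {0, 1, 2} = {3..<Suc K}" by auto
      have b: "R {3..<Suc K}" using K by (intro interval) auto
      have "shared 0 y"
        using K a b step[of 1] True
        by (intro sharedI[of 1 2]) (auto simp: numeral_2_eq_2)
      with no0y show False by simp
    next
      case False
      then have y2: "y \<ge> 2" using ev by (cases y) (auto elim: oddE)
      have a: "{..K} - {K, 0, 1} = {2..<K}" using K by auto
      have b: "R {2..<K}" using K by (intro interval) auto
      have c: "{..K} - {y, 0, 1} = {2..<y} \<union> {Suc y..<Suc K}" using y y2 by auto
      have d: "R ({2..<y} \<union> {Suc y..<Suc K})"
        using K y y2 ev by (intro union interval) auto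
      have "shared K y"
        using K a b c d step[of 0] y2 by (intro sharedI[of 0 1]) auto
      with noKy show False by simp
    qed
  qed
  then have yK: "y < K" using y K by (cases "y = K") auto
  have y0: "0 < y" using y_odd by (cases y) auto
  \<comment> \<open>A chord between positions of different parity can be completed by path edges to a matching
    avoiding an end of the path, where it is then shared; likewise for a chord crossing another
    one of different parity.\<close>
  have parity: "even i = even j" if "chord i j" for i j
  proof (rule ccontr)
    assume ne: "even i \<noteq> even j"
    note c = that[unfolded chord_def]
    show False
    proof (cases "even i")
      case True
      have jK: "j < K" using c ne True K by (cases "j = K") auto
      have a: "{..K} - {K, i, j} = {0..<i} \<union> ({Suc i..<j} \<union> {Suc j..<K})" using c jK by auto
      have "R ({0..<i} \<union> ({Suc i..<j} \<union> {Suc j..<K}))"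
        using c ne True K jK by (intro union interval) auto
      then have "shared K y" using c a jK by (intro sharedI[of i j]) auto
      with noKy show False by simp
    next
      case False
      then have i0: "0 < i" by (cases i) auto
      have a: "{..K} - {0, i, j} = {1..<i} \<union> ({Suc i..<j} \<union> {Suc j..<Suc K})" using c i0 by auto
      have "R ({1..<i} \<union> ({Suc i..<j} \<union> {Suc j..<Suc K}))"
        using c ne False K i0 by (intro union interval) auto
      then have "shared 0 y" using c a i0 by (intro sharedI[of i j]) auto
      with no0y show False by simp
    qed
  qed
  have nocross: "\<not> (i < k \<and> k < j \<and> j < l)"
    if ij: "chord i j" and kl: "chord k l" and ne: "even i \<noteq> even k" for i j k l
  proof
    assume o: "i < k \<and> k < j \<and> j < l"
    note c = ij[unfolded chord_def] kl[unfolded chord_def] parity[OF ij] parity[OF kl]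
    have jl: "j \<le> K" "l \<le> K" using c by auto
    show False
    proof (cases "even i")
      case True
      have lK: "l < K" using c ne True K by (cases "l = K") auto
      have a: "{..K} - {K, i, j} = {0..<i} \<union> ({Suc i..<k} \<union>
          ({Suc k..<j} \<union> ({Suc j..<l} \<union> ({Suc l..<K} \<union> {k, l}))))"
      proof -
        have "{..K} - {K, i, j} = {0..<K} - {i, j}" using jl by auto
        then show ?thesis
          using interval_minus_crossing_pair[of 0 i k j l K] o lK by simp
      qed
      have "R ({0..<i} \<union> ({Suc i..<k} \<union>
          ({Suc k..<j} \<union> ({Suc j..<l} \<union> ({Suc l..<K} \<union> {k, l})))))"
        using c ne True K lK o by (intro union interval pair) auto
      then have "shared K y" using c a lK o by (intro sharedI[of i j]) auto
      with noKy show False by simp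
    next
      case False
      then have i0: "0 < i" by (cases i) auto
      have a: "{..K} - {0, i, j} = {1..<i} \<union> ({Suc i..<k} \<union>
          ({Suc k..<j} \<union> ({Suc j..<l} \<union> ({Suc l..<Suc K} \<union> {k, l}))))"
      proof -
        have "{..K} - {0, i, j} = {1..<Suc K} - {i, j}" using jl by auto
        then show ?thesis
          using interval_minus_crossing_pair[of 1 i k j l "Suc K"] o i0 jl by simp
      qed
      have "R ({1..<i} \<union> ({Suc i..<k} \<union>
          ({Suc k..<j} \<union> ({Suc j..<l} \<union> ({Suc l..<Suc K} \<union> {k, l})))))"
        using c ne False K i0 o by (intro union interval pair) auto
      then have "shared 0 y" using c a i0 o by (intro sharedI[of i j]) auto
      with no0y show False by simp
    qed
  qed
  \<comment> \<open>Here \<open>i\<close> and \<open>j\<close> are even and \<open>y\<close> is odd,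
    so the chord and path edges together match the path minus \<open>y\<close>. A path edge from
    \<open>k\<close> to \<open>k + 1\<close> used there also occurs in the path matching avoiding
    \<open>K\<close> if \<open>k\<close> is even, and in the one avoiding \<open>0\<close> if
    \<open>k\<close> is odd. So each of the four gaps must be empty, which leaves the
    triangle.\<close>
  have notover: "\<not> (i < y \<and> y < j)" if ij: "chord i j" and ev: "even i" for i j
  proof
    assume o: "i < y \<and> y < j"
    note c = ij[unfolded chord_def] parity[OF ij]
    have K_sh: "shared K y" if "i > 0"
    proof -
      have i2: "i \<ge> 2" using that ev by (cases i) (auto elim: oddE)
      have a: "{..K} - {K, 0, 1} = {2..<K}" using K by auto
      have b: "R {2..<K}" using K by (intro interval) auto
      have e: "{..K} - {y, 0, 1} = {2..<i} \<union> ({Suc i..<y} \<union> ({Suc y..<j} \<union> ({Suc j..<Suc K} \<union> {i, j})))"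
        using c o i2 by auto
      have f: "R ({2..<i} \<union> ({Suc i..<y} \<union> ({Suc y..<j} \<union> ({Suc j..<Suc K} \<union> {i, j}))))"
        using c o i2 ev K y_odd by (intro union interval pair) auto
      show ?thesis using K a b e f step[of 0] o i2 by (intro sharedI[of 0 1]) auto
    qed
    have left_sh: "shared 0 y" if "y > Suc i"
    proof -
      have y3: "y \<ge> i + 3" using that ev y_odd by presburger
      have a: "{..K} - {0, Suc i, i+2} = {1..<Suc i} \<union> {i+3..<Suc K}" using c by auto
      have b: "R ({1..<Suc i} \<union> {i+3..<Suc K})" using K ev y3 y by (intro union interval) auto
      have e: "{..K} - {y, Suc i, i+2} =
          {0..<i} \<union> ({i+3..<y} \<union> ({Suc y..<j} \<union> ({Suc j..<Suc K} \<union> {i, j})))"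
        using c o y3 by auto
      have f: "R ({0..<i} \<union> ({i+3..<y} \<union> ({Suc y..<j} \<union> ({Suc j..<Suc K} \<union> {i, j}))))"
        using c o y3 ev K y_odd by (intro union interval pair) auto
      show ?thesis using K a b e f step[of "Suc i"] o y3 y by (intro sharedI[of "Suc i" "i+2"]) auto
    qed
    have right_sh: "shared K y" if "j > Suc y"
    proof -
      have j3: "j \<ge> y + 3" using that ev c y_odd by presburger
      have a: "{..K} - {K, Suc y, y+2} = {0..<Suc y} \<union> {y+3..<K}" using c j3 by auto
      have b: "R ({0..<Suc y} \<union> {y+3..<K})" using K ev c j3 y_odd by (intro union interval) auto
      have e: "{..K} - {y, Suc y, y+2} =
          {0..<i} \<union> ({Suc i..<y} \<union> ({y+3..<j} \<union> ({Suc j..<Suc K} \<union> {i, j})))"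
        using c o j3 by auto
      have f: "R ({0..<i} \<union> ({Suc i..<y} \<union> ({y+3..<j} \<union> ({Suc j..<Suc K} \<union> {i, j}))))"
        using c o j3 ev K y_odd by (intro union interval pair) auto
      show ?thesis using K a b e f step[of "Suc y"] o j3 c by (intro sharedI[of "Suc y" "y+2"]) auto
    qed
    have end_sh: "shared 0 y" if "j < K"
    proof -
      have j2: "j + 2 \<le> K" using that ev c K by presburger
      have a: "{..K} - {0, Suc j, j+2} = {1..<Suc j} \<union> {j+3..<Suc K}" using c by auto
      have b: "R ({1..<Suc j} \<union> {j+3..<Suc K})" using K ev c j2 by (intro union interval) auto
      have e: "{..K} - {y, Suc j, j+2} =
          {0..<i} \<union> ({Suc i..<y} \<union> ({Suc y..<j} \<union> ({j+3..<Suc K} \<union> {i, j})))"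
        using c o j2 by auto
      have f: "R ({0..<i} \<union> ({Suc i..<y} \<union> ({Suc y..<j} \<union> ({j+3..<Suc K} \<union> {i, j}))))"
        using c o j2 ev K y_odd by (intro union interval pair) auto
      show ?thesis using K a b e f step[of "Suc j"] o j2 c by (intro sharedI[of "Suc j" "j+2"]) auto
    qed
    have "\<not> 0 < i" "\<not> Suc i < y" "\<not> Suc y < j" "\<not> j < K"
      using K_sh left_sh right_sh end_sh noKy no0y by blast+
    then have "i = 0" "y = 1" "j = 2" "K = 2" using o c by linarith+
    moreover have "adj i j" using c by simp
    ultimately show False using notri by blast
  qed
  \<comment> \<open>The successor of the left end of a shortest chord has a chord of its own, which by the above
    is nested inside and thus shorter.\<close>
  define shortest where "shortest = (LEAST n. \<exists>i j. chord i j \<and> n = j - i)"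
  have "\<exists>n i j. chord i j \<and> n = j - i" using chord_ex[of 0] y0 by auto
  then have "\<exists>i j. chord i j \<and> shortest = j - i" unfolding shortest_def by (rule LeastI_ex)
  then obtain i j where ij: "chord i j" and len: "shortest = j - i" by blast
  have min: "j - i \<le> l - k" if "chord k l" for k l
    unfolding len[symmetric] shortest_def using that by (intro Least_le) auto
  note c = ij[unfolded chord_def] parity[OF ij]
  have j2: "j \<ge> i + 2" using c by (cases "j = Suc i") auto
  \<comment> \<open>If \<open>Suc i\<close> were \<open>y\<close>, then \<open>i\<close> would be
    even and the chord would jump over \<open>y\<close>.\<close>
  have ny: "Suc i \<noteq> y"
    using notover[OF ij] y_odd j2 by auto
  obtain m where "chord (Suc i) m \<or> chord m (Suc i)" using chord_ex[of "Suc i"] ny c by auto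
  then show False
  proof
    assume m: "chord (Suc i) m"
    have "m \<noteq> j" using c parity[OF m] by auto
    moreover have "\<not> j < m" using nocross[OF ij m] j2 by auto
    ultimately have "m - Suc i < j - i" using m[unfolded chord_def] j2 by auto
    with min[OF m] show False by simp
  next
    assume m: "chord m (Suc i)"
    have "m \<noteq> i" using parity[OF m] by auto
    moreover have "m < Suc i" using m[unfolded chord_def] by auto
    ultimately have "m < i" by auto
    with nocross[OF m ij] parity[OF m] j2 show False by auto
  qed
qed

section \<open>Matched vertex sets\<close>

text \<open>Only the covered vertex set is recorded, not the edges. Unions, removals and changes of
  the graph then become inductions on how the set was built, and different matchings of the same set
  are interchangeable.\<close>

inductive matched :: "('v, 'e) mgraph \<Rightarrow> 'v set \<Rightarrow> bool" for G where
  matched_empty: "matched G {}"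
| matched_insert: "matched G A \<Longrightarrow> e \<in> edges G \<Longrightarrow> ends G e \<inter> A = {} \<Longrightarrow> matched G (A \<union> ends G e)"

lemma matched_edge: "e \<in> edges G \<Longrightarrow> matched G (ends G e)"
  using matched_insert[OF matched_empty] by fastforce

lemma matched_Un:
  assumes "matched G B" "matched G A" "A \<inter> B = {}"
  shows "matched G (A \<union> B)"
  using assms
proof (induction rule: matched.induct)
  case (matched_insert B e)
  then have "matched G (A \<union> B)" by blast
  then have "matched G ((A \<union> B) \<union> ends G e)"
    using matched_insert by (intro matched.matched_insert) auto
  then show ?case by (simp add: Un_assoc)
qed simp

lemma matched_UN:
  assumes "finite I" "\<And>i. i \<in> I \<Longrightarrow> matched G (A i)"
    and "\<And>i j. i \<in> I \<Longrightarrow> j \<in> I \<Longrightarrow> i \<noteq> j \<Longrightarrow> A i \<inter> A j = {}"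
  shows "matched G (\<Union>i\<in>I. A i)"
  using assms
proof (induction rule: finite_induct)
  case (insert i I)
  then show ?case using matched_Un[of G "\<Union>i\<in>I. A i" "A i"] by fastforce
qed (simp add: matched_empty)

text \<open>Insertions of disjoint edges commute, so the edge covering \<open>v\<close> may be taken
  as the last one inserted.\<close>

lemma matched_remove_edge:
  assumes "matched G A" "v \<in> A"
  obtains e where "e \<in> edges G" "v \<in> ends G e" "ends G e \<subseteq> A" "matched G (A - ends G e)"
proof -
  have "\<exists>e\<in>edges G. v \<in> ends G e \<and> ends G e \<subseteq> A \<and> matched G (A - ends G e)"
    using assms
  proof (induction rule: matched.induct)
    case (matched_insert A e)
    show ?case
    proof (cases "v \<in> ends G e")
      case True
      have "A \<union> ends G e - ends G e = A" using matched_insert by auto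
      with True matched_insert show ?thesis by (intro bexI[of _ e]) auto
    next
      case False
      then obtain f where f: "f \<in> edges G" "v \<in> ends G f" "ends G f \<subseteq> A" "matched G (A - ends G f)"
        using matched_insert by auto
      have "A \<union> ends G e - ends G f = (A - ends G f) \<union> ends G e" using f matched_insert by auto
      moreover have "matched G ((A - ends G f) \<union> ends G e)"
        using f matched_insert by (intro matched.matched_insert) auto
      ultimately show ?thesis using f by (intro bexI[of _ f]) auto
    qed
  qed simp
  then show ?thesis using that by blast
qed

lemma ends_props:
  assumes "graph G" "e \<in> edges G"
  shows "ends G e \<subseteq> verts G" "card (ends G e) = 2" "finite (ends G e)" "ends G e \<noteq> {}"
  using assms by (auto simp: graph_def intro: finite_subset)

lemma ends_eq_pair:
  assumes "graph G" "e \<in> edges G" "u \<in> ends G e"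
  obtains v where "ends G e = {u, v}" "u \<noteq> v"
proof -
  obtain a b where "ends G e = {a, b}" "a \<noteq> b"
    using ends_props(2)[OF assms(1,2)] by (auto simp: card_2_iff)
  then show ?thesis using that[of a] that[of b] assms(3) by (auto simp: insert_commute)
qed

lemma matched_imp_subset:
  assumes "graph G" "matched G A"
  shows "A \<subseteq> verts G"
  using assms(2,1) by (induction rule: matched.induct) (auto dest: ends_props)

lemma matched_imp_matching:
  assumes "matched G A"
  obtains M where "M \<subseteq> edges G" "(\<Union>e\<in>M. ends G e) = A"
    "\<forall>v\<in>A. \<exists>!e. e \<in> M \<and> v \<in> ends G e"
proof -
  have "\<exists>M\<subseteq>edges G. (\<Union>e\<in>M. ends G e) = A \<and> (\<forall>v\<in>A. \<exists>!e. e \<in> M \<and> v \<in> ends G e)"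
    using assms
  proof (induction rule: matched.induct)
    case (matched_insert A e)
    then obtain M where M: "M \<subseteq> edges G" "(\<Union>e\<in>M. ends G e) = A"
      "\<forall>v\<in>A. \<exists>!e. e \<in> M \<and> v \<in> ends G e" by blast
    have "\<exists>!f. f \<in> insert e M \<and> v \<in> ends G f" if "v \<in> A \<union> ends G e" for v
    proof (cases "v \<in> A")
      case True
      then have "v \<notin> ends G e" using matched_insert by auto
      then show ?thesis using M(3) True by (auto intro: ex1I)
    next
      case False
      then show ?thesis using M(2) that by auto
    qed
    then show ?case using M matched_insert by (intro exI[of _ "insert e M"]) auto
  qed auto
  then show ?thesis by (elim exE conjE) (rule that)
qed

lemma matchedI_matching:
  assumes "finite M" "M \<subseteq> edges G" "\<And>e. e \<in> M \<Longrightarrow> ends G e \<subseteq> A"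
    and ex1: "\<And>v. v \<in> A \<Longrightarrow> \<exists>!e. e \<in> M \<and> v \<in> ends G e"
  shows "matched G A"
proof -
  have "A = (\<Union>e\<in>M. ends G e)"
  proof
    show "A \<subseteq> (\<Union>e\<in>M. ends G e)" using ex1 by (meson UN_I ex1_implies_ex subsetI)
  qed (use assms(3) in blast)
  moreover have "matched G (\<Union>e\<in>M. ends G e)"
  proof (rule matched_UN)
    fix e f assume "e \<in> M" "f \<in> M" "e \<noteq> f"
    then show "ends G e \<inter> ends G f = {}" using assms(3)[of e] ex1 by fast
  qed (use assms in \<open>auto intro: matched_edge\<close>)
  ultimately show ?thesis by simp
qed

lemma matchable_delete_verts_iff:
  assumes "graph G"
  shows "matchable (delete_verts G X) \<longleftrightarrow> matched G (verts G - X)"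
proof
  assume "matchable (delete_verts G X)"
  then obtain M where "perfect_matching (delete_verts G X) M" unfolding matchable_def by blast
  then have M: "M \<subseteq> edges (delete_verts G X)"
    "\<forall>v\<in>verts G - X. \<exists>!e. e \<in> M \<and> v \<in> ends G e"
    by (simp_all add: perfect_matching_def delete_verts_def)
  have "finite M" using M(1) assms by (auto simp: delete_verts_def graph_def intro: finite_subset)
  then show "matched G (verts G - X)"
  proof (rule matchedI_matching)
    show "ends G e \<subseteq> verts G - X" if "e \<in> M" for e
      using ends_props(1)[OF assms, of e] M(1) that by (auto simp: delete_verts_def)
    show "M \<subseteq> edges G" using M(1) by (auto simp: delete_verts_def)
    show "\<exists>!e. e \<in> M \<and> v \<in> ends G e" if "v \<in> verts G - X" for v using M(2) that by (rule bspec)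
  qed
next
  assume "matched G (verts G - X)"
  then obtain M where M: "M \<subseteq> edges G" "(\<Union>e\<in>M. ends G e) = verts G - X"
    "\<forall>v\<in>verts G - X. \<exists>!e. e \<in> M \<and> v \<in> ends G e" by (rule matched_imp_matching)
  then have "perfect_matching (delete_verts G X) M"
    unfolding perfect_matching_def by (auto simp: delete_verts_def)
  then show "matchable (delete_verts G X)" unfolding matchable_def by blast
qed

section \<open>Alternating paths and edges shared by two matchings\<close>

text \<open>The path is followed two edges at a time: \<open>e\<close> covers \<open>x\<close> when
  \<open>y\<close> is left out, and \<open>f\<close> covers the other end \<open>z\<close> of
  \<open>e\<close> when \<open>x\<close> is left out. With \<open>t\<close> the far end of
  \<open>f\<close>, the set without \<open>x\<close> and \<open>z\<close> satisfies the hypotheses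
  for \<open>t\<close> and \<open>y\<close>. No symmetric difference of fixed matchings is needed,
  and the vertices off the path stay matchable.\<close>

lemma alternating_path:
  assumes "graph G" "finite S" "x \<in> S" "y \<in> S" "matched G (S - {x})" "matched G (S - {y})"
  obtains p where "p \<noteq> []" "hd p = x" "last p = y" "odd (length p)" "distinct p" "set p \<subseteq> S"
    "matched G (S - set p)" "successively (\<lambda>u v. \<exists>e\<in>edges G. ends G e = {u, v}) p"
proof -
  let ?adj = "\<lambda>u v. \<exists>e\<in>edges G. ends G e = {u, v}"
  have "\<exists>p. p \<noteq> [] \<and> hd p = x \<and> last p = y \<and> odd (length p) \<and> distinct p \<and> set p \<subseteq> S \<and>
      matched G (S - set p) \<and> successively ?adj p"
    using assms(2-)
  proof (induction "card S" arbitrary: S x rule: less_induct)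
    case less
    show ?case
    proof (cases "x = y")
      case True
      then show ?thesis using less.prems by (intro exI[of _ "[x]"]) auto
    next
      case False
      then obtain e where e: "e \<in> edges G" "x \<in> ends G e" "ends G e \<subseteq> S - {y}"
        "matched G (S - {y} - ends G e)"
        using matched_remove_edge[OF less.prems(5), of x] less.prems(2) by blast
      obtain z where z: "ends G e = {x, z}" "x \<noteq> z" by (rule ends_eq_pair[OF assms(1) e(1,2)])
      obtain f where f: "f \<in> edges G" "z \<in> ends G f" "ends G f \<subseteq> S - {x}"
        "matched G (S - {x} - ends G f)"
        using matched_remove_edge[OF less.prems(4), of z] z e by blast
      obtain t where t: "ends G f = {z, t}" "z \<noteq> t" by (rule ends_eq_pair[OF assms(1) f(1,2)])
      let ?S = "S - {x, z}"
      have "card ?S < card S" using less.prems by (intro psubset_card_mono) auto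
      moreover have "?S - {y} = S - {y} - ends G e" "?S - {t} = S - {x} - ends G f"
        using z t by auto
      ultimately obtain p where p: "p \<noteq> []" "hd p = t" "last p = y" "odd (length p)" "distinct p"
        "set p \<subseteq> ?S" "matched G (?S - set p)" "successively ?adj p"
        using less.hyps[of ?S t] less.prems e f z t by auto
      have "S - set (x # z # p) = ?S - set p" by auto
      moreover have "successively ?adj (x # z # p)"
        using p e f z t by (cases p) auto
      ultimately show ?thesis
        using p e z by (intro exI[of _ "x # z # p"]) auto
    qed
  qed
  then show ?thesis using that by blast
qed

text \<open>The sets \<^term>\<open>S - {x}\<close> and \<^term>\<open>S - {y}\<close> have perfect matchings with a common edge.\<close>

definition shared_edge :: "('v, 'e) mgraph \<Rightarrow> 'v set \<Rightarrow> 'v \<Rightarrow> 'v \<Rightarrow> bool" where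
  "shared_edge G S x y \<longleftrightarrow> (\<exists>e\<in>edges G. ends G e \<subseteq> S - {x, y} \<and>
     matched G (S - {x} - ends G e) \<and> matched G (S - {y} - ends G e))"

lemma matched_path_segment:
  fixes q :: "nat \<Rightarrow> 'v"
  assumes "inj_on q {..K}" "\<And>k. k < K \<Longrightarrow> \<exists>e\<in>edges G. ends G e = {q k, q (Suc k)}"
    and "l + 2 * m \<le> Suc K"
  shows "matched G (q ` {l..<l + 2 * m})"
  using assms(3)
proof (induction m)
  case (Suc m)
  let ?k = "l + 2 * m"
  obtain e where e: "e \<in> edges G" "ends G e = {q ?k, q (Suc ?k)}"
    using assms(2)[of ?k] Suc.prems by auto
  have "q i \<noteq> q ?k \<and> q i \<noteq> q (Suc ?k)" if "l \<le> i" "i < ?k" for i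
    using inj_onD[OF assms(1), of i] that Suc.prems by fastforce
  then have "ends G e \<inter> q ` {l..<?k} = {}" unfolding e(2) by force
  then have "matched G (q ` {l..<?k} \<union> ends G e)"
    using Suc e by (intro matched_insert) auto
  moreover have "{l..<l + 2 * Suc m} = {l..<?k} \<union> {?k, Suc ?k}" by auto
  then have "q ` {l..<l + 2 * Suc m} = q ` {l..<?k} \<union> ends G e" unfolding e(2) by auto
  ultimately show ?case by (simp only:)
qed (simp add: matched_empty)

lemma path_shared_edge_or_triangle:
  fixes q :: "nat \<Rightarrow> 'v"
  assumes G: "graph G" and inj: "inj_on q {..K}"
    and path: "\<And>k. k < K \<Longrightarrow> \<exists>e\<in>edges G. ends G e = {q k, q (Suc k)}"
    and K: "even K" "K \<ge> 2" and y: "y \<le> K" and third: "matched G (q ` {..K} - {q y})"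
  defines "S \<equiv> q ` {..K}"
  shows "K = 2 \<and> y = 1 \<and> (\<exists>e\<in>edges G. ends G e = {q 0, q 2}) \<or>
    shared_edge G S (q 0) (q y) \<or> shared_edge G S (q K) (q y)"
proof -
  \<comment> \<open>The bound on \<open>A\<close> makes \<open>q\<close> injective on all sets
    concerned, so that disjoint sets of positions have disjoint images.\<close>
  define R where "R A \<longleftrightarrow> A \<subseteq> {..K} \<and> matched G (q ` A)" for A
  define adj where "adj i j \<longleftrightarrow> (\<exists>e\<in>edges G. ends G e = {q i, q j})" for i j
  define sh where "sh x z \<longleftrightarrow> (\<exists>i\<le>K. \<exists>j\<le>K. i \<noteq> j \<and> adj i j \<and> {i, j} \<inter> {x, z} = {} \<and>
    R ({..K} - {x, i, j}) \<and> R ({..K} - {z, i, j}))" for x z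
  have img: "q ` ({..K} - {x, i, j}) = S - {q x} - {q i, q j}"
    if "x \<le> K" "i \<le> K" "j \<le> K" for x i j
    using that inj unfolding S_def by (auto simp: inj_on_eq_iff)
  have trans: "shared_edge G S (q x) (q z)"
    if sh: "sh x z" and xz: "x \<le> K" "z \<le> K" for x z
  proof -
    obtain i j where ij: "i \<le> K" "j \<le> K" "adj i j" "{i, j} \<inter> {x, z} = {}"
      "R ({..K} - {x, i, j})" "R ({..K} - {z, i, j})" using sh unfolding sh_def by blast
    obtain e where e: "e \<in> edges G" "ends G e = {q i, q j}" using ij unfolding adj_def by blast
    have "ends G e \<subseteq> S - {q x, q z}"
      using e ij xz inj unfolding S_def by (auto simp: inj_on_eq_iff)
    moreover have "matched G (S - {q x} - ends G e)" "matched G (S - {q z} - ends G e)"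
      using ij img[OF xz(1) ij(1,2)] img[OF xz(2) ij(1,2)] e unfolding R_def by auto
    ultimately show ?thesis using e unfolding shared_edge_def by blast
  qed
  have "K = 2 \<and> y = 1 \<and> adj 0 2 \<or> sh 0 y \<or> sh K y"
    unfolding sh_def
  proof (rule path_three_matchings)
    show "R (A \<union> B)" if "R A" "R B" "A \<inter> B = {}" for A B
    proof -
      have "q ` A \<inter> q ` B = q ` (A \<inter> B)"
        using that inj unfolding R_def by (intro inj_on_image_Int[symmetric]) auto
      then show ?thesis using that matched_Un[of G "q ` B" "q ` A"]
        unfolding R_def by (auto simp: image_Un)
    qed
    show "R {l..<r}" if lr: "l \<le> r" "r \<le> Suc K" "even l = even r" for l r
    proof -
      have "r = l + 2 * ((r - l) div 2)" using lr by presburger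
      then show ?thesis
        using matched_path_segment[OF inj path, of l "(r - l) div 2"] lr unfolding R_def by auto
    qed
    show "R {i, j}" if ij: "i < j" "j \<le> K" "adj i j" for i j
    proof -
      obtain e where "e \<in> edges G" "ends G e = {q i, q j}" using ij(3) unfolding adj_def by blast
      then show ?thesis using matched_edge[of e G] ij unfolding R_def by auto
    qed
    show "adj k (Suc k)" if "k < K" for k using path that unfolding adj_def by blast
    show "adj j i" if "adj i j" for i j using that unfolding adj_def by (simp add: insert_commute)
    show "\<exists>j\<le>K. j \<noteq> i \<and> j \<noteq> y \<and> adj i j \<and> R ({..K} - {y, i, j})" if i: "i \<le> K" "i \<noteq> y" for i
    proof -
      have "q i \<in> q ` {..K} - {q y}" using i y inj by (auto simp: inj_on_eq_iff)
      then obtain e where e: "e \<in> edges G" "q i \<in> ends G e" "ends G e \<subseteq> q ` {..K} - {q y}"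
        "matched G (q ` {..K} - {q y} - ends G e)" using matched_remove_edge[OF third] by blast
      obtain v where v: "ends G e = {q i, v}" "q i \<noteq> v" by (rule ends_eq_pair[OF G e(1,2)])
      then obtain j where j: "j \<le> K" "v = q j" using e by auto
      then have "j \<noteq> i" "j \<noteq> y" using v e by auto
      moreover have "R ({..K} - {y, i, j})"
        using e(4) img[OF y i(1) j(1)] v j unfolding R_def S_def by auto
      ultimately show ?thesis using e(1) v j unfolding adj_def by blast
    qed
  qed (use K y in auto)
  then show ?thesis
    using trans[of 0 y] trans[of K y] y by (simp only: adj_def) auto
qed

text \<open>The alternating path joins \<open>x1\<close> and \<open>x2\<close>. If it misses part of
  \<open>S\<close>, an edge there serves for both; otherwise \<open>x3\<close> is on the path and
  its position is compared with the two ends. The three vertices may coincide: for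
  \<open>x1 = x2\<close> the path is a single vertex.\<close>

lemma shared_edge_or_triangle:
  assumes G: "graph G" and S: "finite S" and x: "x1 \<in> S" "x2 \<in> S" "x3 \<in> S"
    and m: "matched G (S - {x1})" "matched G (S - {x2})" "matched G (S - {x3})"
  obtains "S = {x1}"
  | "shared_edge G S x1 x2 \<or> shared_edge G S x1 x3 \<or> shared_edge G S x2 x3"
  | "S = {x1, x2, x3}" "distinct [x1, x2, x3]" "\<exists>e\<in>edges G. ends G e = {x1, x2}"
    "\<exists>e\<in>edges G. ends G e = {x1, x3}" "\<exists>e\<in>edges G. ends G e = {x2, x3}"
proof -
  obtain p where p: "p \<noteq> []" "hd p = x1" "last p = x2" "odd (length p)" "distinct p" "set p \<subseteq> S"
    "matched G (S - set p)" "successively (\<lambda>u v. \<exists>e\<in>edges G. ends G e = {u, v}) p"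
    by (rule alternating_path[OF G S x(1,2) m(1,2)])
  define K where "K = length p - 1"
  have lenp: "length p = Suc K" and K_ev: "even K" using p(1,4) unfolding K_def by (cases p; auto)+
  have inj: "inj_on ((!) p) {..K}" using p(5) lenp by (auto simp: inj_on_def nth_eq_iff_index_eq)
  have path: "\<exists>e\<in>edges G. ends G e = {p ! k, p ! Suc k}" if "k < K" for k
    using p(8) that lenp by (auto simp: successively_conv_nth)
  have set_p: "set p = (!) p ` {..K}" using lenp
    by (auto simp: set_conv_nth image_def less_Suc_eq_le)
  have p0: "p ! 0 = x1" and pK: "p ! K = x2"
    using p(1-3) lenp by (auto simp: hd_conv_nth last_conv_nth)
  show ?thesis
  proof (cases "S = set p")
    case False
    \<comment> \<open>Off the path, one of the two matchings can be used in both places.\<close>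
    then obtain v where "v \<in> S - set p" using p(6) by blast
    then obtain e where e: "e \<in> edges G" "ends G e \<subseteq> S - set p" "matched G (S - set p - ends G e)"
      using matched_remove_edge[OF p(7)] by blast
    have "matched G ((S - set p - ends G e) \<union> (set p - {z}))" if "z = x1 \<or> z = x2" for z
    proof (rule matched_Un)
      have seg: "matched G ((!) p ` {0..<K})" "matched G ((!) p ` {1..<Suc K})"
        using matched_path_segment[OF inj path, of 0 "K div 2"]
          matched_path_segment[OF inj path, of 1 "K div 2"] K_ev by auto
      have "{0..<K} = {..K} - {K}" "{1..<Suc K} = {..K} - {0}" by auto
      then have "(!) p ` {0..<K} = set p - {x2}" "(!) p ` {1..<Suc K} = set p - {x1}"
        unfolding set_p p0[symmetric] pK[symmetric]
        using inj_on_image_set_diff[OF inj, of "{..K}" "{K}"]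
          inj_on_image_set_diff[OF inj, of "{..K}" "{0}"] by auto
      with seg that show "matched G (set p - {z})" by auto
    qed (use e in auto)
    moreover have "(S - set p - ends G e) \<union> (set p - {z}) = S - {z} - ends G e" 
      if "z = x1 \<or> z = x2" for z
      using that e p(1-3,6) by auto
    ultimately have "shared_edge G S x1 x2" unfolding shared_edge_def
      using e p(1-3) by (intro bexI[of _ e]) auto
    then show ?thesis using that by blast
  next
    case True
    show ?thesis
    proof (cases "K = 0")
      case True
      then have "S = {x1}" using \<open>S = set p\<close> set_p p0 by auto
      then show ?thesis using that by blast
    next
      case False
      then have K2: "K \<ge> 2" using K_ev by presburger
      obtain y where y: "y \<le> K" "x3 = p ! y" using x(3) True set_p by auto
      have S_eq: "S = (!) p ` {..K}" using True set_p by simp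
      have "K = 2 \<and> y = 1 \<and> (\<exists>e\<in>edges G. ends G e = {p ! 0, p ! 2}) \<or>
          shared_edge G S (p ! 0) (p ! y) \<or> shared_edge G S (p ! K) (p ! y)"
        unfolding S_eq using m(3) S_eq y
        by (intro path_shared_edge_or_triangle[OF G inj path K_ev K2]) auto
      then show ?thesis
      proof
        assume t: "K = 2 \<and> y = 1 \<and> (\<exists>e\<in>edges G. ends G e = {p ! 0, p ! 2})"
        have idx: "p ! 0 = x1" "p ! 1 = x3" "p ! 2 = x2" using p0 pK y t by auto
        have "{..K} = {0, 1, 2}" using t by auto
        then have "S = {x1, x2, x3}" using S_eq idx by auto
        moreover have "distinct [x1, x2, x3]"
          unfolding idx[symmetric] using p(5) lenp t by (simp add: nth_eq_iff_index_eq)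
        moreover have "\<exists>e\<in>edges G. ends G e = {x1, x3}" "\<exists>e\<in>edges G. ends G e = {x3, x2}"
          using path[of 0] path[of 1] idx t by (auto simp: numeral_2_eq_2)
        moreover have "\<exists>e\<in>edges G. ends G e = {x1, x2}" using t idx by simp
        ultimately show ?thesis using that(3) by (simp add: insert_commute)
      next
        assume "shared_edge G S (p ! 0) (p ! y) \<or> shared_edge G S (p ! K) (p ! y)"
        then show ?thesis using that(2) p0 pK y by auto
      qed
    qed
  qed
qed

section \<open>Expansions\<close>

text \<open>Shrinking each \<open>S v\<close> in a graph \<open>G\<close>, after deleting a matchable part of it, gives a graph
  that contains \<open>K\<close>, where the edge \<open>e\<close> of \<open>K\<close> is the image of the edge \<open>\<phi> e\<close> of \<open>G\<close>.\<close>

definition expansion :: "('w, 'f) mgraph \<Rightarrow> ('v, 'e) mgraph \<Rightarrow> ('w \<Rightarrow> 'v set) \<Rightarrow> ('f \<Rightarrow> 'e) \<Rightarrow> bool" where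
  "expansion K G S \<phi> \<longleftrightarrow> (\<forall>v\<in>verts K. S v \<subseteq> verts G) \<and>
     (\<forall>u\<in>verts K. \<forall>v\<in>verts K. u \<noteq> v \<longrightarrow> S u \<inter> S v = {}) \<and>
     \<phi> ` edges K \<subseteq> edges G \<and> inj_on \<phi> (edges K) \<and>
     (\<forall>e\<in>edges K. ends G (\<phi> e) \<subseteq> (\<Union>v\<in>ends K e. S v)) \<and>
     (\<forall>e\<in>edges K. \<forall>v\<in>ends K e. ends G (\<phi> e) \<inter> S v \<noteq> {} \<and> matched G (S v - ends G (\<phi> e))) \<and>
     matched G (verts G - (\<Union>v\<in>verts K. S v))"

lemma expansionD:
  assumes "expansion K G S \<phi>"
  shows "v \<in> verts K \<Longrightarrow> S v \<subseteq> verts G"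
    and "u \<in> verts K \<Longrightarrow> v \<in> verts K \<Longrightarrow> u \<noteq> v \<Longrightarrow> S u \<inter> S v = {}"
    and "e \<in> edges K \<Longrightarrow> \<phi> e \<in> edges G"
    and "inj_on \<phi> (edges K)"
    and "e \<in> edges K \<Longrightarrow> ends G (\<phi> e) \<subseteq> (\<Union>v\<in>ends K e. S v)"
    and "e \<in> edges K \<Longrightarrow> v \<in> ends K e \<Longrightarrow> ends G (\<phi> e) \<inter> S v \<noteq> {}"
    and "e \<in> edges K \<Longrightarrow> v \<in> ends K e \<Longrightarrow> matched G (S v - ends G (\<phi> e))"
    and "matched G (verts G - (\<Union>v\<in>verts K. S v))"
  using assms unfolding expansion_def by blast+

text \<open>The edge has two ends and meets the disjoint sets of both ends of \<open>e\<close>, so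
  each of these sets gets exactly one.\<close>

lemma expansion_end_in:
  assumes "graph K" "graph G" "expansion K G S \<phi>" "e \<in> edges K" "v \<in> ends K e"
  obtains x where "ends G (\<phi> e) \<inter> S v = {x}"
proof -
  obtain u where u: "ends K e = {v, u}" "v \<noteq> u" by (rule ends_eq_pair[OF assms(1,4,5)])
  have uv: "v \<in> verts K" "u \<in> verts K" using ends_props(1)[OF assms(1,4)] u by auto
  obtain x where x: "x \<in> ends G (\<phi> e)" "x \<in> S v" using expansionD(6)[OF assms(3,4,5)] by blast
  obtain y where y: "ends G (\<phi> e) = {x, y}" "x \<noteq> y"
    by (rule ends_eq_pair[OF assms(2) expansionD(3)[OF assms(3,4)] x(1)])
  have "S v \<inter> S u = {}" using expansionD(2)[OF assms(3)] uv u by blast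
  moreover have "ends G (\<phi> e) \<inter> S u \<noteq> {}" using expansionD(6)[OF assms(3,4), of u] u by simp
  ultimately have "y \<notin> S v" using x y by auto
  then show ?thesis using x y that[of x] by auto
qed

text \<open>A matching edge \<open>e\<close> with ends \<open>u\<close> and \<open>v\<close> lifts
  to \<open>\<phi> e\<close> together with matchings of \<open>S u\<close> and \<open>S v\<close>
  minus the ends of \<open>\<phi> e\<close>.\<close>

lemma expansion_matched:
  assumes "graph K" "expansion K G S \<phi>" "matched K A"
  shows "matched G (\<Union>v\<in>A. S v)"
  using assms(3)
proof (induction rule: matched.induct)
  case (matched_insert A e)
  let ?E = "ends G (\<phi> e)"
  note D = expansionD[OF assms(2)]
  obtain u where "u \<in> ends K e" using ends_props(4)[OF assms(1) matched_insert(2)] by blast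
  then obtain v where uv: "ends K e = {u, v}" "u \<noteq> v"
    by (rule ends_eq_pair[OF assms(1) matched_insert(2)])
  have in_verts: "u \<in> verts K" "v \<in> verts K" "A \<subseteq> verts K"
    using ends_props(1)[OF assms(1) matched_insert(2)] uv
      matched_imp_subset[OF assms(1) matched_insert(1)] by auto
  have disj: "S u \<inter> S v = {}" using D(2) in_verts uv by blast
  have sub: "?E \<subseteq> S u \<union> S v" using D(5)[OF matched_insert(2)] uv by auto
  have "matched G ((S u - ?E) \<union> ((S v - ?E) \<union> ?E))"
    using D(3,7)[OF matched_insert(2)] uv disj by (intro matched_Un matched_edge) auto
  moreover have "(S u - ?E) \<union> ((S v - ?E) \<union> ?E) = S u \<union> S v" using sub by auto
  moreover have "S w \<inter> (S u \<union> S v) = {}" if "w \<in> A" for w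
    using D(2)[of w u] D(2)[of w v] that in_verts uv matched_insert(3) by auto
  ultimately have "matched G ((\<Union>v\<in>A. S v) \<union> (S u \<union> S v))"
    using matched_insert.IH by (intro matched_Un[of G "S u \<union> S v"]) auto
  then show ?case using uv by (simp add: Un_ac)
qed (simp add: matched_empty)

text \<open>The edge \<open>\<psi> e\<close> attaches to one vertex \<open>w\<close> of
  \<open>T v\<close>. Leaving out the end of \<open>\<phi> (\<psi> e)\<close> only affects
  \<open>S w\<close>, which stays matchable without it, while the matching of \<open>T v\<close>
  minus \<open>w\<close> lifts to the remaining sets by \<open>expansion_matched\<close>.\<close>

lemma expansion_trans:
  assumes gr: "graph K" "graph G" "graph L"
    and KG: "expansion K G S \<phi>" and LK: "expansion L K T \<psi>"
  shows "expansion L G (\<lambda>v. \<Union>w\<in>T v. S w) (\<phi> \<circ> \<psi>)"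
proof -
  note K = expansionD[OF KG] and L = expansionD[OF LK]
  have endsL: "v \<in> verts L" if "v \<in> ends L e" "e \<in> edges L" for v e
    using ends_props(1)[OF gr(3)] that by blast
  have disj: "S w \<inter> S w' = {}" if "w \<in> T v" "v \<in> verts L" "w' \<in> T v'" "v' \<in> verts L" "w \<noteq> w'"
    for v v' w w'
    using K(2) L(1)[of v] L(1)[of v'] that by blast
  show ?thesis
    unfolding expansion_def
  proof (intro conjI ballI impI)
    fix v assume "v \<in> verts L"
    then show "(\<Union>w\<in>T v. S w) \<subseteq> verts G" using K(1) L(1) by blast
  next
    fix u v assume uv: "u \<in> verts L" "v \<in> verts L" "u \<noteq> v"
    then show "(\<Union>w\<in>T u. S w) \<inter> (\<Union>w\<in>T v. S w) = {}"
      using disj[of _ u _ v] L(2)[OF uv] by blast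
  next
    show "(\<phi> \<circ> \<psi>) ` edges L \<subseteq> edges G" using K(3) L(3) by auto
    show "inj_on (\<phi> \<circ> \<psi>) (edges L)"
      using K(4) L(3,4) by (intro comp_inj_on) (auto intro: inj_on_subset)
  next
    fix e assume e: "e \<in> edges L"
    show "ends G ((\<phi> \<circ> \<psi>) e) \<subseteq> (\<Union>v\<in>ends L e. \<Union>w\<in>T v. S w)"
      using K(5)[OF L(3)[OF e]] L(5)[OF e] by fastforce
    fix v assume v: "v \<in> ends L e"
    obtain w where w: "ends K (\<psi> e) \<inter> T v = {w}"
      by (rule expansion_end_in[OF gr(3,1) LK e v])
    show "ends G ((\<phi> \<circ> \<psi>) e) \<inter> (\<Union>w\<in>T v. S w) \<noteq> {}"
      using K(6)[OF L(3)[OF e], of w] w by auto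
    have vL: "v \<in> verts L" using endsL[OF v e] .
    have other: "ends G (\<phi> (\<psi> e)) \<inter> S w' = {}" if w': "w' \<in> T v - ends K (\<psi> e)" for w'
    proof -
      have "S w'' \<inter> S w' = {}" if "w'' \<in> ends K (\<psi> e)" for w''
        using K(2)[of w'' w'] ends_props(1)[OF gr(1) L(3)[OF e]] L(1)[OF vL] w' that by blast
      then show ?thesis using K(5)[OF L(3)[OF e]] by blast
    qed
    have "matched G ((\<Union>w\<in>T v - ends K (\<psi> e). S w) \<union> (S w - ends G (\<phi> (\<psi> e))))"
    proof (rule matched_Un)
      show "matched G (\<Union>w\<in>T v - ends K (\<psi> e). S w)"
        using expansion_matched[OF gr(1) KG L(7)[OF e v]] .
      show "matched G (S w - ends G (\<phi> (\<psi> e)))" using K(7)[OF L(3)[OF e]] w by auto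
      have "S w' \<inter> S w = {}" if "w' \<in> T v - ends K (\<psi> e)" for w'
        using that w by (intro disj[OF _ vL _ vL]) auto
      then show "(\<Union>w\<in>T v - ends K (\<psi> e). S w) \<inter> (S w - ends G (\<phi> (\<psi> e))) = {}" by auto
    qed
    moreover have "(\<Union>w\<in>T v. S w) - ends G (\<phi> (\<psi> e)) =
        (\<Union>w\<in>T v - ends K (\<psi> e). S w) \<union> (S w - ends G (\<phi> (\<psi> e)))" (is "?A - ?E = ?B")
    proof
      have "w' = w" if "w' \<in> T v" "w' \<in> ends K (\<psi> e)" for w' using that w by auto
      then show "?A - ?E \<subseteq> ?B" by fast
      have "w \<in> T v" using w by auto
      with other show "?B \<subseteq> ?A - ?E" by auto
    qed
    ultimately show "matched G ((\<Union>w\<in>T v. S w) - ends G ((\<phi> \<circ> \<psi>) e))" by simp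
  next
    \<comment> \<open>What remains of \<open>G\<close> is what the expansion of \<open>K\<close>
      leaves over, together with the lift of what the expansion of \<open>L\<close> leaves over in
      \<open>K\<close>.\<close>
    have "matched G ((verts G - (\<Union>v\<in>verts K. S v)) \<union>
        (\<Union>w\<in>verts K - (\<Union>v\<in>verts L. T v). S w))"
      using K(8) expansion_matched[OF gr(1) KG L(8)] by (intro matched_Un) auto
    moreover have "verts G - (\<Union>v\<in>verts L. \<Union>w\<in>T v. S w) = (verts G - (\<Union>v\<in>verts K. S v)) \<union>
        (\<Union>w\<in>verts K - (\<Union>v\<in>verts L. T v). S w)" (is "?A = ?B")
    proof
      show "?A \<subseteq> ?B" by auto
      have "S w \<inter> S w' = {}" if "w \<in> verts K - (\<Union>v\<in>verts L. T v)" "w' \<in> T v" "v \<in> verts L" for w w' v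
        using K(2)[of w w'] L(1)[of v] that by blast
      then have "(\<Union>w\<in>verts K - (\<Union>v\<in>verts L. T v). S w) \<inter>
          (\<Union>v\<in>verts L. \<Union>w\<in>T v. S w) = {}" by fast
      moreover have "(\<Union>v\<in>verts L. \<Union>w\<in>T v. S w) \<subseteq> (\<Union>v\<in>verts K. S v)" using L(1) by blast
      moreover have "(\<Union>w\<in>verts K - (\<Union>v\<in>verts L. T v). S w) \<subseteq> verts G" using K(1) by blast
      ultimately show "?B \<subseteq> ?A" by (intro Un_least Diff_mono)
          (simp_all only: order_refl le_iff_inf Diff_eq Int_assoc[symmetric] disjoint_eq_subset_Compl)
    qed
    ultimately show "matched G (verts G - (\<Union>v\<in>verts L. \<Union>w\<in>T v. S w))" by simp
  qed
qed

section \<open>Conformal minors as embeddings of subdivisions\<close>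

definition conformal_embedding ::
  "('w, 'f) mgraph \<Rightarrow> ('v, 'e) mgraph \<Rightarrow> ('w \<Rightarrow> 'v) \<Rightarrow> ('f \<Rightarrow> 'e) \<Rightarrow> bool" where
  "conformal_embedding K G f g \<longleftrightarrow> inj_on f (verts K) \<and> f ` verts K \<subseteq> verts G \<and>
     inj_on g (edges K) \<and> g ` edges K \<subseteq> edges G \<and>
     (\<forall>e\<in>edges K. ends G (g e) = f ` ends K e) \<and> matched G (verts G - f ` verts K)"

lemma conformal_embedding_imp_expansion:
  assumes "graph K" "conformal_embedding K G f g"
  shows "expansion K G (\<lambda>v. {f v}) g"
proof -
  have "{f v} - f ` ends K e = {}" if "v \<in> ends K e" for v e using that by auto
  then show ?thesis
    using assms(2) matched_empty[of G] unfolding conformal_embedding_def expansion_def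
    by (auto simp: inj_on_eq_iff UNION_singleton_eq_range)
qed

lemma conformal_copy_iff_embedding:
  assumes G: "graph G" and K: "graph K"
  shows "(\<exists>H. conformal H G \<and> isomorphic H K) \<longleftrightarrow> (\<exists>f g. conformal_embedding K G f g)"
proof
  assume "\<exists>H. conformal H G \<and> isomorphic H K"
  then obtain H f g where H: "subgraph H G" "matchable (delete_verts G (verts H))"
    and f: "bij_betw f (verts H) (verts K)" and g: "bij_betw g (edges H) (edges K)"
    and fg: "\<And>e. e \<in> edges H \<Longrightarrow> ends K (g e) = f ` ends H e"
    unfolding conformal_def isomorphic_def by (elim exE conjE) simp
  let ?f = "inv_into (verts H) f" and ?g = "inv_into (edges H) g"
  have f': "bij_betw ?f (verts K) (verts H)" and g': "bij_betw ?g (edges K) (edges H)"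
    using f g by (auto intro: bij_betw_inv_into)
  have "ends G (?g e) = ?f ` ends K e" if e: "e \<in> edges K" for e
  proof -
    have ge: "?g e \<in> edges H" "g (?g e) = e"
      using e g g' by (auto simp: bij_betw_def f_inv_into_f)
    have "ends H (?g e) \<subseteq> verts H" using H(1) ge unfolding subgraph_def by (intro ends_props) auto
    then have "?f ` f ` ends H (?g e) = ends H (?g e)"
      using f by (intro inv_into_image_cancel) (auto simp: bij_betw_def)
    then show ?thesis using fg[OF ge(1)] ge H(1) unfolding subgraph_def by auto
  qed
  then have "conformal_embedding K G ?f ?g"
    using f' g' H unfolding conformal_embedding_def subgraph_def bij_betw_def
    by (auto simp: matchable_delete_verts_iff[OF G])
  then show "\<exists>f g. conformal_embedding K G f g" by blast
next
  assume "\<exists>f g. conformal_embedding K G f g"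
  then obtain f g where fg: "conformal_embedding K G f g" by blast
  note E = fg[unfolded conformal_embedding_def]
  let ?H = "\<lparr>verts = f ` verts K, edges = g ` edges K, ends = ends G\<rparr>"
  let ?f = "inv_into (verts K) f" and ?g = "inv_into (edges K) g"
  have "card (ends G (g e)) = 2" if "e \<in> edges K" for e
    using ends_props(2)[OF G] E that by blast
  then have "graph ?H" using K E unfolding graph_def by auto
  then have "subgraph ?H G" using E unfolding subgraph_def by simp
  then have "conformal ?H G" using E unfolding conformal_def
    by (simp add: matchable_delete_verts_iff[OF G])
  moreover have "isomorphic ?H K"
    unfolding isomorphic_def
  proof (intro exI conjI ballI)
    show "bij_betw ?f (verts ?H) (verts K)" "bij_betw ?g (edges ?H) (edges K)"
      using E bij_betw_inv_into[of f "verts K" "f ` verts K"]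
        bij_betw_inv_into[of g "edges K" "g ` edges K"] by (simp_all add: bij_betw_def)
    fix x assume "x \<in> edges ?H"
    then obtain e where e: "e \<in> edges K" "x = g e" by auto
    have "?f ` f ` ends K e = ends K e"
      using E ends_props(1)[OF K e(1)] by (intro inv_into_image_cancel) auto
    then show "ends K (?g x) = ?f ` ends ?H x" using e E by simp
  qed
  ultimately show "\<exists>H. conformal H G \<and> isomorphic H K" by blast
qed

lemma sub_vertex_inj_on:
  assumes "a e \<noteq> b e"
  shows "inj_on (sub_vertex a b s e) {..Suc (s e)}"
  using assms unfolding inj_on_def sub_vertex_def by (auto split: if_splits)

lemma graph_subdivide:
  assumes L: "graph L" and ab: "\<forall>e\<in>edges L. ends L e = {a e, b e}"
  shows "graph (subdivide L a b s)"
proof -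
  have ab': "a e \<noteq> b e" "a e \<in> verts L" "b e \<in> verts L" if "e \<in> edges L" for e
    using ends_props(1,2)[OF L that] ab that by (auto simp: card_2_iff doubleton_eq_iff)
  have fin: "finite (SIGMA e : edges L. {..s e})" using L unfolding graph_def by auto
  have "{Inr (e, i) |e i. e \<in> edges L \<and> 1 \<le> i \<and> i \<le> s e} \<subseteq> Inr ` (SIGMA e : edges L. {..s e})"
    "{(e, i) |e i. e \<in> edges L \<and> i \<le> s e} = (SIGMA e : edges L. {..s e})" by auto
  then have "finite (verts (subdivide L a b s))" "finite (edges (subdivide L a b s))"
    using fin finite_subset[OF _ finite_imageI[OF fin]] L unfolding graph_def subdivide_def by auto
  moreover have "sub_vertex a b s e i \<noteq> sub_vertex a b s e (Suc i)" if "e \<in> edges L" "i \<le> s e" for e i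
    using inj_onD[OF sub_vertex_inj_on[of a e b s]] ab'[OF that(1)] that(2) by fastforce
  ultimately show ?thesis
    unfolding graph_def using ab' by (auto simp: subdivide_def sub_vertex_def)
qed

lemma conformal_minor_iff_embedding:
  assumes "graph G" "graph L"
  shows "conformal_minor L G \<longleftrightarrow> (\<exists>a b s f g. (\<forall>e\<in>edges L. ends L e = {a e, b e} \<and> even (s e)) \<and>
    conformal_embedding (subdivide L a b s) G f g)"
proof -
  let ?P = "\<lambda>a b s. \<forall>e\<in>edges L. ends L e = {a e, b e} \<and> even (s e)"
  have eq: "(\<exists>H. conformal H G \<and> isomorphic H (subdivide L a b s)) \<longleftrightarrow>
      (\<exists>f g. conformal_embedding (subdivide L a b s) G f g)" if "?P a b s" for a b s
    using that by (intro conformal_copy_iff_embedding[OF assms(1)] graph_subdivide[OF assms(2)]) blast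
  have "conformal_minor L G \<longleftrightarrow>
      (\<exists>a b s. ?P a b s \<and> (\<exists>H. conformal H G \<and> isomorphic H (subdivide L a b s)))"
    unfolding conformal_minor_def bisubdivision_def by blast
  also have "\<dots> \<longleftrightarrow> (\<exists>a b s. ?P a b s \<and> (\<exists>f g. conformal_embedding (subdivide L a b s) G f g))"
    by (simp only: eq cong: conj_cong)
  finally show ?thesis by (simp only: ex_simps)
qed

lemma expansion_subdivide:
  assumes L: "graph L" and ab: "\<forall>e\<in>edges L. ends L e = {a e, b e} \<and> even (s e)"
  \<comment> \<open>The inner vertices of the path replacing \<open>e\<close> all go to the end \<open>b e\<close>.\<close>
  defines "S \<equiv> \<lambda>v. insert (Inl v) (\<Union>e\<in>{e \<in> edges L. b e = v}. sub_vertex a b s e ` {1..<1 + s e})"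
  shows "expansion L (subdivide L a b s) S (\<lambda>e. (e, 0))"
proof -
  let ?D = "subdivide L a b s" and ?sv = "sub_vertex a b s"
  have ab': "a e \<noteq> b e" "a e \<in> verts L" "b e \<in> verts L" if "e \<in> edges L" for e
    using ends_props(1,2)[OF L that] ab that by (auto simp: card_2_iff doubleton_eq_iff)
  have seg: "matched ?D (?sv e ` {l..<l + 2 * m})" if e: "e \<in> edges L" "l + 2 * m \<le> s e + 2" for e l m
  proof (rule matched_path_segment[OF sub_vertex_inj_on])
    show "\<exists>x\<in>edges ?D. ends ?D x = {?sv e k, ?sv e (Suc k)}" if "k < Suc (s e)" for k
      using e that by (intro bexI[of _ "(e, k)"]) (auto simp: subdivide_def)
  qed (use e ab' in auto)
  have inner: "?sv e ` {1..<1 + s e} = {Inr (e, i) |i. 1 \<le> i \<and> i \<le> s e}" for e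
    unfolding sub_vertex_def by (auto simp: image_iff)
  have whole: "matched ?D (\<Union>e\<in>F. ?sv e ` {1..<1 + s e})" if F: "F \<subseteq> edges L" for F
  proof (rule matched_UN)
    show "finite F" using F L unfolding graph_def by (auto intro: finite_subset)
    show "matched ?D (?sv e ` {1..<1 + s e})" if "e \<in> F" for e
      using seg[of e 1 "s e div 2"] that F ab by auto
    show "?sv e ` {1..<1 + s e} \<inter> ?sv f ` {1..<1 + s f} = {}" if "e \<noteq> f" for e f
      unfolding inner using that by auto
  qed
  have S_eq: "S v = insert (Inl v) {Inr (e, i) |e i. e \<in> edges L \<and> b e = v \<and> 1 \<le> i \<and> i \<le> s e}" for v
    unfolding S_def inner by auto
  have end0: "ends ?D (e, 0) = {Inl (a e), if s e = 0 then Inl (b e) else Inr (e, 1)}" for e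
    by (simp add: subdivide_def sub_vertex_def)
  show ?thesis
    unfolding expansion_def
  proof (intro conjI ballI impI)
    fix v assume "v \<in> verts L"
    then show "S v \<subseteq> verts ?D" unfolding S_eq by (auto simp: subdivide_def)
  next
    fix u v assume "u \<in> verts L" "v \<in> verts L" "u \<noteq> v"
    then show "S u \<inter> S v = {}" unfolding S_eq by auto
  next
    fix e assume e: "e \<in> edges L"
    show "ends ?D (e, 0) \<subseteq> (\<Union>v\<in>ends L e. S v)"
      using e ab unfolding S_eq end0 by auto
    fix v assume v: "v \<in> ends L e"
    show "ends ?D (e, 0) \<inter> S v \<noteq> {}" using v e ab unfolding end0 S_eq by auto
    show "matched ?D (S v - ends ?D (e, 0))"
    proof (cases "v = a e")
      case True
      \<comment> \<open>At the start of its path, \<open>(e, 0)\<close> removes only the branch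
        vertex. The inner paths assigned to \<open>v\<close> remain whole and are matched
        separately, each having an even number of vertices.\<close>
      have "S v - ends ?D (e, 0) = (\<Union>f\<in>{f \<in> edges L. b f = v}. ?sv f ` {1..<1 + s f})"
        using True ab'[OF e] unfolding inner S_eq end0 by auto
      then show ?thesis using whole[of "{f \<in> edges L. b f = v}"] by simp
    next
      case False
      then have v: "v = b e" using v ab e by auto
      \<comment> \<open>At the far end, \<open>(e, 0)\<close> removes position 1. The positions from
        2 to \<open>s e + 1\<close> remain, again evenly many, and the last of them is the branch
        vertex \<open>Inl v\<close>. For \<open>s e = 0\<close> position 1 is itself
        \<open>Inl v\<close>, so nothing is left.\<close>
      have last: "?sv e ` {2..<2 + s e} = (if s e = 0 then {} else insert (Inl v) {Inr (e, i) |i. 2 \<le> i \<and> i \<le> s e})"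
      proof -
        have "s e \<noteq> 0 \<Longrightarrow> {2..<2 + s e} = insert (Suc (s e)) {2..s e}" by auto
        then show ?thesis unfolding v sub_vertex_def by (auto simp: image_iff)
      qed
      have "matched ?D ((\<Union>f\<in>{f \<in> edges L. b f = v \<and> f \<noteq> e}. ?sv f ` {1..<1 + s f}) \<union> ?sv e ` {2..<2 + s e})"
      proof (rule matched_Un)
        show "matched ?D (?sv e ` {2..<2 + s e})" using seg[of e 2 "s e div 2"] e ab by auto
        show "matched ?D (\<Union>f\<in>{f \<in> edges L. b f = v \<and> f \<noteq> e}. ?sv f ` {1..<1 + s f})"
          by (rule whole) auto
        show "(\<Union>f\<in>{f \<in> edges L. b f = v \<and> f \<noteq> e}. ?sv f ` {1..<1 + s f}) \<inter> ?sv e ` {2..<2 + s e} = {}"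
          unfolding inner last by auto
      qed
      moreover have "S v - ends ?D (e, 0) =
          (\<Union>f\<in>{f \<in> edges L. b f = v \<and> f \<noteq> e}. ?sv f ` {1..<1 + s f}) \<union> ?sv e ` {2..<2 + s e}"
        using False v e unfolding inner S_eq end0 last by auto
      ultimately show ?thesis by simp
    qed
  next
    have "verts ?D - (\<Union>v\<in>verts L. S v) = {}" unfolding S_eq using ab' by (auto simp: subdivide_def)
    then show "matched ?D (verts ?D - (\<Union>v\<in>verts L. S v))" using matched_empty by metis
  qed (auto simp: subdivide_def inj_on_def)
qed

section \<open>Splicing triangles into a cubic graph\<close>

lemma cubic_incident_edges:
  assumes "cubic J" "v \<in> verts J" "e \<in> edges J" "v \<in> ends J e"
  obtains f g where "{x \<in> edges J. v \<in> ends J x} = {e, f, g}" "distinct [e, f, g]"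
proof -
  let ?I = "{x \<in> edges J. v \<in> ends J x}"
  have card: "card ?I = 3" using assms by (auto simp: cubic_def degree_def)
  then have "finite ?I" by (intro card_ge_0_finite) simp
  then have "card (?I - {e}) = 2" using card assms by simp
  then obtain f g where fg: "?I - {e} = {f, g}" "f \<noteq> g" by (auto simp: card_2_iff)
  then have "?I = {e, f, g}" using assms by auto
  moreover have "distinct [e, f, g]" using fg by auto
  ultimately show ?thesis using that by blast
qed

lemma graph_splice_K4:
  assumes J: "graph J"
  shows "graph (splice_K4 J T)"
proof -
  let ?P = "splice_K4 J T"
  have fin: "finite (verts J)" "finite (edges J)" using J by (auto simp: graph_def)
  have "verts ?P \<subseteq> Inl ` verts J \<union> Inr ` (verts J \<times> edges J)"
    using ends_props(1)[OF J] by (auto simp: splice_K4_def)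
  then have "finite (verts ?P)" using fin finite_subset by fastforce
  moreover have "edges ?P \<subseteq> Inl ` edges J \<union> Inr ` (verts J \<times> Pow (edges J))"
    using ends_props(1)[OF J] by (auto simp: splice_K4_def)
  then have "finite (edges ?P)" using fin finite_subset by fastforce
  moreover have "ends ?P x \<subseteq> verts ?P \<and> card (ends ?P x) = 2" if x: "x \<in> edges ?P" for x
  proof (cases x)
    case (Inl e)
    then have e: "e \<in> edges J" using x by (auto simp: splice_K4_def)
    obtain u where "u \<in> ends J e" using ends_props(4)[OF J e] by blast
    then obtain v where "ends J e = {u, v}" "u \<noteq> v" by (rule ends_eq_pair[OF J e])
    then have uv: "ends ?P x = {splice_vertex T e u, splice_vertex T e v}" "u \<noteq> v"
      "u \<in> verts J" "v \<in> verts J" "u \<in> ends J e" "v \<in> ends J e"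
      using Inl ends_props(1)[OF J e] by (auto simp: splice_K4_def)
    moreover have "splice_vertex T e w \<in> verts ?P" if "w \<in> ends J e" "w \<in> verts J" for w
      using that e by (auto simp: splice_K4_def splice_vertex_def)
    moreover have "splice_vertex T e u \<noteq> splice_vertex T e v"
      using uv(2) by (simp add: splice_vertex_def)
    ultimately show ?thesis by simp
  next
    case (Inr y)
    then obtain v e f where "y = (v, {e, f})" "v \<in> T" "e \<noteq> f" "e \<in> edges J" "v \<in> ends J e"
      "f \<in> edges J" "v \<in> ends J f" using x by (auto simp: splice_K4_def)
    then show ?thesis using Inr by (auto simp: splice_K4_def)
  qed
  ultimately show ?thesis by (simp add: graph_def)
qed

text \<open>A triangle minus any one of its vertices is an edge, hence matchable, just as a single
  vertex minus itself is empty.\<close>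

lemma expansion_splice_K4:
  assumes J: "graph J" and cub: "cubic J" and T: "T \<subseteq> verts J"
  defines "S \<equiv> \<lambda>v. if v \<in> T then {Inr (v, e) |e. e \<in> edges J \<and> v \<in> ends J e} else {Inl v}"
  shows "expansion J (splice_K4 J T) S Inl"
  unfolding expansion_def
proof (intro conjI ballI impI)
  let ?P = "splice_K4 J T"
  have verts_P: "verts ?P = Inl ` (verts J - T) \<union>
      {Inr (v, e) |v e. v \<in> T \<and> e \<in> edges J \<and> v \<in> ends J e}"
    by (simp add: splice_K4_def)
  fix v assume v: "v \<in> verts J"
  then show "S v \<subseteq> verts ?P" by (auto simp: S_def splice_K4_def)
  fix u assume "u \<in> verts J" "v \<noteq> u"
  then show "S v \<inter> S u = {}" by (auto simp: S_def)
next
  fix e assume e: "e \<in> edges J"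
  let ?P = "splice_K4 J T"
  have ends_P: "ends ?P (Inl e) = splice_vertex T e ` ends J e" by (simp add: splice_K4_def)
  then show "ends ?P (Inl e) \<subseteq> (\<Union>v\<in>ends J e. S v)"
    using e by (auto simp: S_def splice_vertex_def)
  fix v assume v: "v \<in> ends J e"
  then show "ends ?P (Inl e) \<inter> S v \<noteq> {}" using e ends_P by (auto simp: S_def splice_vertex_def)
  show "matched ?P (S v - ends ?P (Inl e))"
  proof (cases "v \<in> T")
    case False
    then have "Inl v = splice_vertex T e v" by (simp add: splice_vertex_def)
    then have "S v - ends ?P (Inl e) = {}" using v False unfolding ends_P S_def by simp
    then show ?thesis using matched_empty by metis
  next
    case True
    obtain f g where fg: "{x \<in> edges J. v \<in> ends J x} = {e, f, g}" "distinct [e, f, g]"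
      using cubic_incident_edges[OF cub _ e v] v ends_props(1)[OF J e] by blast
    have inc: "x \<in> edges J \<and> v \<in> ends J x \<longleftrightarrow> x \<in> {e, f, g}" for x using fg(1) by blast
    have "S v = {Inr (v, e), Inr (v, f), Inr (v, g)}"
      using True unfolding S_def inc by auto
    moreover have "Inr (v, e) \<in> ends ?P (Inl e)"
      using True v unfolding ends_P by (force simp: splice_vertex_def)
    moreover have "Inr (v, f) \<notin> ends ?P (Inl e)" "Inr (v, g) \<notin> ends ?P (Inl e)"
      using fg(2) unfolding ends_P by (auto simp: splice_vertex_def)
    ultimately have "S v - ends ?P (Inl e) = {Inr (v, f), Inr (v, g)}"
      by (simp add: insert_Diff_if)
    also have "\<dots> = ends ?P (Inr (v, {f, g}))" by (simp add: splice_K4_def)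
    also have "matched ?P \<dots>"
      using True fg(2) inc[of f] inc[of g] by (intro matched_edge) (auto simp: splice_K4_def)
    finally show ?thesis .
  qed
next
  let ?P = "splice_K4 J T"
  have "verts ?P - (\<Union>v\<in>verts J. S v) = {}" using T by (auto simp: splice_K4_def S_def)
  then show "matched ?P (verts ?P - (\<Union>v\<in>verts J. S v))" using matched_empty by metis
qed (auto simp: splice_K4_def)

section \<open>Contractions of a separating cut\<close>

lemma contract_sel:
  "verts (contract G X) = insert None (Some ` (verts G - X))"
  "edges (contract G X) = {e \<in> edges G. \<not> ends G e \<subseteq> X}"
  "ends (contract G X) e = (\<lambda>v. if v \<in> X then None else Some v) ` ends G e"
  by (simp_all add: contract_def)

lemma graph_contract:
  assumes G: "graph G"
  shows "graph (contract G X)"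
proof -
  have "ends (contract G X) e \<subseteq> verts (contract G X) \<and> card (ends (contract G X) e) = 2"
    if "e \<in> edges (contract G X)" for e
  proof -
    have e: "e \<in> edges G" "\<not> ends G e \<subseteq> X" using that by (auto simp: contract_sel)
    then obtain u where u: "u \<in> ends G e" "u \<notin> X" by blast
    then obtain v where v: "ends G e = {u, v}" "u \<noteq> v" using ends_eq_pair[OF G e(1)] by blast
    then have "u \<in> verts G" "v \<in> verts G" using ends_props(1)[OF G e(1)] by auto
    then show ?thesis using u v by (cases "v \<in> X") (simp_all add: contract_sel)
  qed
  then show ?thesis using G by (simp add: graph_def contract_sel)
qed

text \<open>Take a perfect matching of the contraction that contains \<open>e\<close>. Since
  \<open>e\<close> already covers the contracted vertex \<open>None\<close>, all its other edges lie
  inside \<open>X\<close>, where they match everything but \<open>x\<close>.\<close>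

lemma boundary_end_matched:
  assumes G: "graph G" and X: "X \<subseteq> verts G" and mc: "matching_covered (contract G (verts G - X))"
    and e: "e \<in> edges G" and x: "ends G e \<inter> X = {x}"
  shows "matched G (X - {x})"
proof -
  let ?H = "contract G (verts G - X)"
  have "e \<in> edges ?H" using e x by (auto simp: contract_sel)
  then obtain M where M: "perfect_matching ?H M" "e \<in> M"
    using mc unfolding matching_covered_def by blast
  have M_edges: "M \<subseteq> edges G" using M(1) by (auto simp: perfect_matching_def contract_sel)
  obtain y where y: "ends G e = {x, y}" "x \<noteq> y" using ends_eq_pair[OF G e] x by blast
  have "y \<in> verts G - X" using y x ends_props(1)[OF G e] by auto
  then have None_e: "None \<in> ends ?H e" using y by (auto simp: contract_sel)
  have ex1: "\<exists>!f. f \<in> M \<and> w \<in> ends ?H f" if "w \<in> verts ?H" for w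
    using M(1) that unfolding perfect_matching_def by blast
  have Some_iff: "Some v \<in> ends ?H f \<longleftrightarrow> v \<in> ends G f" if "v \<in> X" for v f
    using that by (auto simp: contract_sel)
  have others: "ends G f \<subseteq> X" if "f \<in> M - {e}" for f
  proof -
    have "None \<notin> ends ?H f" using ex1[of None] None_e M(2) that by (auto simp: contract_sel(1))
    then have "ends G f \<inter> (verts G - X) = {}" by (auto simp: contract_sel image_iff)
    then show ?thesis using ends_props(1)[OF G, of f] M_edges that by blast
  qed
  show ?thesis
  proof (rule matchedI_matching)
    show "finite (M - {e})" using M_edges G by (auto simp: graph_def intro: finite_subset)
    show "M - {e} \<subseteq> edges G" using M_edges by blast
    show "ends G f \<subseteq> X - {x}" if f: "f \<in> M - {e}" for f
    proof -
      have "x \<notin> ends G f"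
      proof
        assume "x \<in> ends G f"
        then have "Some x \<in> ends ?H f" "Some x \<in> ends ?H e" using x Some_iff by auto
        moreover have "Some x \<in> verts ?H" using x X by (auto simp: contract_sel)
        ultimately show False using ex1[of "Some x"] f M(2) by blast
      qed
      then show ?thesis using others[OF f] by blast
    qed
    show "\<exists>!f. f \<in> M - {e} \<and> v \<in> ends G f" if v: "v \<in> X - {x}" for v
    proof -
      have "v \<notin> ends G e" using v x by auto
      moreover have "\<exists>!f. f \<in> M \<and> v \<in> ends G f"
        using ex1[of "Some v"] v X Some_iff[of v] by (auto simp: contract_sel(1))
      ultimately show ?thesis by (auto intro: ex1I)
    qed
  qed
qed

text \<open>Only the vertex \<open>None\<close> of \<open>G/X\<close> is expanded, to
  \<open>X\<close> itself. That \<open>X\<close> minus the end of any edge leaving it is matchable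
  is information about the opposite contraction, in which \<open>X\<close> survives and its
  complement is shrunk.\<close>

lemma expansion_contract:
  assumes G: "graph G" and X: "X \<subseteq> verts G" and mc: "matching_covered (contract G (verts G - X))"
  defines "S \<equiv> case_option X (\<lambda>v. {v})"
  shows "expansion (contract G X) G S id"
  unfolding expansion_def
proof (intro conjI ballI impI)
  let ?H = "contract G X"
  fix v assume "v \<in> verts ?H"
  then show "S v \<subseteq> verts G" using X by (auto simp: contract_sel S_def)
next
  fix u v assume "u \<in> verts (contract G X)" "v \<in> verts (contract G X)" "u \<noteq> v"
  then show "S u \<inter> S v = {}" by (auto simp: contract_sel S_def)
next
  fix e assume e: "e \<in> edges (contract G X)"
  let ?H = "contract G X"
  show "ends G (id e) \<subseteq> (\<Union>v\<in>ends ?H e. S v)" by (auto simp: contract_sel S_def)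
  fix v assume v: "v \<in> ends ?H e"
  then show "ends G (id e) \<inter> S v \<noteq> {}" by (auto simp: contract_sel S_def split: if_splits)
  have eG: "e \<in> edges G" "\<not> ends G e \<subseteq> X" using e by (auto simp: contract_sel)
  show "matched G (S v - ends G (id e))"
  proof (cases v)
    case None
    then obtain x where x: "x \<in> X" "x \<in> ends G e" using v by (auto simp: contract_sel split: if_splits)
    then obtain y where "ends G e = {x, y}" using ends_eq_pair[OF G eG(1)] by blast
    then have "ends G e \<inter> X = {x}" "X - ends G e = X - {x}" using x eG(2) by auto
    then show ?thesis
      using boundary_end_matched[OF G X mc eG(1)] None by (simp add: S_def)
  next
    case (Some w)
    then have "S v - ends G (id e) = {}" using v by (auto simp: contract_sel S_def split: if_splits)
    then show ?thesis using matched_empty by metis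
  qed
next
  have "verts G - (\<Union>v\<in>verts (contract G X). S v) = {}" by (auto simp: contract_sel S_def)
  then show "matched G (verts G - (\<Union>v\<in>verts (contract G X). S v))" using matched_empty by metis
qed (auto simp: contract_sel)

lemma splice_minor_contract_imp_expansion:
  assumes G: "graph G" and X: "X \<subseteq> verts G" and mc: "matching_covered (contract G (verts G - X))"
    and J: "graph J" and cub: "cubic J" and T: "T \<subseteq> verts J"
    and minor: "conformal_minor (splice_K4 J T) (contract G X)"
  shows "\<exists>S \<phi>. expansion J G S \<phi>"
proof -
  let ?P = "splice_K4 J T" and ?H = "contract G X"
  have P: "graph ?P" and H: "graph ?H" using graph_splice_K4[OF J] graph_contract[OF G] by auto
  obtain a b s f g where ab: "\<forall>e\<in>edges ?P. ends ?P e = {a e, b e} \<and> even (s e)"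
    and fg: "conformal_embedding (subdivide ?P a b s) ?H f g"
    using minor unfolding conformal_minor_iff_embedding[OF H P] by (elim exE conjE)
  have D: "graph (subdivide ?P a b s)" using ab by (intro graph_subdivide[OF P]) auto
  \<comment> \<open>The chain leads from \<open>J\<close> to its splicing, from there to the
    bi-subdivision, then to \<open>G/X\<close> and finally to \<open>G\<close>.\<close>
  note steps = expansion_splice_K4[OF J cub T] expansion_subdivide[OF P ab]
    conformal_embedding_imp_expansion[OF D fg] expansion_contract[OF G X mc]
  show ?thesis
    using expansion_trans[OF H G J steps(4) expansion_trans[OF D H J steps(3)
      expansion_trans[OF P D J steps(2) steps(1)]]] by blast
qed

section \<open>Suppressing a path with three edges\<close>

text \<open>The conditions \<open>a \<noteq> w\<close> and \<open>b \<noteq> u\<close> say that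
  \<open>d\<close> and \<open>f\<close> are not parallel to \<open>e\<close>;
  \<open>a \<noteq> b\<close> ensures that suppressing the path creates no loop.\<close>

locale inner_edge =
  fixes G :: "('v, 'e) mgraph" and e d f :: 'e and u w a b :: 'v
  assumes G: "graph G" and e: "e \<in> edges G" "ends G e = {u, w}"
    and d: "d \<in> edges G" "ends G d = {a, u}" and f: "f \<in> edges G" "ends G f = {w, b}"
    and ab: "a \<noteq> w" "b \<noteq> u" "a \<noteq> b"
begin

lemma distinct_ends: "u \<noteq> w" "a \<noteq> u" "b \<noteq> w"
  using ends_props(2)[OF G e(1)] ends_props(2)[OF G d(1)] ends_props(2)[OF G f(1)] e d f by auto

lemma distinct_edges: "e \<noteq> d" "e \<noteq> f" "d \<noteq> f"
  using distinct_ends ab e d f by (auto simp: doubleton_eq_iff)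

text \<open>The path \<open>a, u, w, b\<close> with edges \<open>d\<close>, \<open>e\<close>, \<open>f\<close> is replaced by the single edge \<open>d\<close>.\<close>

definition shortcut :: "('v, 'e) mgraph" where
  "shortcut = \<lparr>verts = verts G - {u, w},
     edges = insert d {x \<in> edges G. ends G x \<inter> {u, w} = {}}, ends = (ends G)(d := {a, b})\<rparr>"

lemma shortcut_sel:
  "verts shortcut = verts G - {u, w}"
  "edges shortcut = insert d {x \<in> edges G. ends G x \<inter> {u, w} = {}}"
  "ends shortcut d = {a, b}"
  "x \<noteq> d \<Longrightarrow> ends shortcut x = ends G x"
  by (simp_all add: shortcut_def)

lemma graph_shortcut: "graph shortcut"
proof -
  have "a \<in> verts G" "b \<in> verts G" using ends_props(1)[OF G d(1)] ends_props(1)[OF G f(1)] d f by auto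
  then show ?thesis
    using G distinct_ends ab unfolding graph_def shortcut_def by auto
qed

lemma matched_shortcutI:
  assumes "matched G A" "A \<inter> {u, w} = {}"
  shows "matched shortcut A"
  using assms
proof (induction rule: matched.induct)
  case (matched_insert A x)
  then have "x \<noteq> d" using d by auto
  then have "ends shortcut x = ends G x" "x \<in> edges shortcut"
    using matched_insert by (auto simp: shortcut_sel)
  then show ?case using matched_insert matched.matched_insert[of shortcut A x] by auto
qed (rule matched_empty)

text \<open>Only \<open>d\<close> is new, and a matching using it would cover both \<open>a\<close>
  and \<open>b\<close>.\<close>

lemma matched_shortcutD:
  assumes "matched shortcut A" "\<not> {a, b} \<subseteq> A"
  shows "matched G A"
  using assms
proof (induction rule: matched.induct)
  case (matched_insert A x)
  then have "x \<noteq> d" by (auto simp: shortcut_sel)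
  then have "ends shortcut x = ends G x" "x \<in> edges G"
    using matched_insert by (auto simp: shortcut_sel)
  then show ?case using matched_insert matched.matched_insert[of G A x] by auto
qed (rule matched_empty)

text \<open>If the matching avoids \<open>d\<close>, then \<open>e\<close> is added; if it uses
  \<open>d\<close> as the edge from \<open>a\<close> to \<open>b\<close>, that edge is replaced by
  the original \<open>d\<close> and \<open>f\<close>. Either way exactly \<open>u\<close> and
  \<open>w\<close> are gained.\<close>

lemma matched_shortcut_expand:
  assumes "matched shortcut A"
  shows "matched G (A \<union> {u, w})"
  using assms
proof (induction rule: matched.induct)
  case matched_empty
  show ?case using matched_edge[OF e(1)] e(2) by simp
next
  case (matched_insert A x)
  have uwA: "u \<notin> A" "w \<notin> A"
    using matched_imp_subset[OF graph_shortcut matched_insert(1)] by (auto simp: shortcut_sel)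
  show ?case
  proof (cases "x = d")
    case True
    then have abA: "a \<notin> A" "b \<notin> A" using matched_insert by (auto simp: shortcut_sel)
    then have "matched G A" using matched_shortcutD[OF matched_insert(1)] by blast
    moreover have "matched G (ends G d \<union> ends G f)"
      using distinct_ends ab d f by (intro matched_Un matched_edge) auto
    ultimately have "matched G (A \<union> (ends G d \<union> ends G f))"
      using uwA abA d f by (intro matched_Un[of G "ends G d \<union> ends G f"]) auto
    moreover have "A \<union> (ends G d \<union> ends G f) = A \<union> ends shortcut x \<union> {u, w}"
      using True d f by (auto simp: shortcut_sel)
    ultimately show ?thesis by (simp only:)
  next
    case False
    then have x: "ends shortcut x = ends G x" "x \<in> edges G" "ends G x \<inter> {u, w} = {}"
      using matched_insert by (auto simp: shortcut_sel)
    then have "matched G (A \<union> {u, w} \<union> ends G x)"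
      using matched_insert by (intro matched.matched_insert) auto
    moreover have "A \<union> {u, w} \<union> ends G x = A \<union> ends shortcut x \<union> {u, w}" using x by auto
    ultimately show ?thesis by (simp only:)
  qed
qed

end

section \<open>Lengthening one path of an embedded subdivision\<close>

lemma subdivide_sel:
  "Inl v \<in> verts (subdivide L a b s) \<longleftrightarrow> v \<in> verts L"
  "Inr (x, j) \<in> verts (subdivide L a b s) \<longleftrightarrow> x \<in> edges L \<and> 1 \<le> j \<and> j \<le> s x"
  "(x, j) \<in> edges (subdivide L a b s) \<longleftrightarrow> x \<in> edges L \<and> j \<le> s x"
  "ends (subdivide L a b s) (x, j) = {sub_vertex a b s x j, sub_vertex a b s x (Suc j)}"
  by (auto simp: subdivide_def)

lemma sub_vertex_in_verts:
  assumes "graph L" "\<forall>e\<in>edges L. ends L e = {a e, b e}" "x \<in> edges L"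
  shows "sub_vertex a b s x j \<in> verts (subdivide L a b s)"
proof -
  have "a x \<in> verts L" "b x \<in> verts L" using ends_props(1)[OF assms(1,3)] assms(2,3) by auto
  then show ?thesis using assms(3) by (auto simp: sub_vertex_def subdivide_def)
qed

text \<open>The image of the edge \<open>(x, i)\<close> is replaced by a path with edges \<open>d\<close>, \<open>e\<close>, \<open>f\<close> and inner
  vertices \<open>u\<close>, \<open>w\<close>, so that \<open>x\<close> is subdivided twice more. The function \<open>en\<close> gives the ends of
  edges in the target graph.\<close>

lemma subdivide_embedding_extend:
  fixes F :: "'w + 'f \<times> nat \<Rightarrow> 'v" and g :: "'f \<times> nat \<Rightarrow> 'e"
  assumes L: "graph L" and ab: "\<forall>e\<in>edges L. ends L e = {a e, b e}"
    and x: "x \<in> edges L" "i \<le> s x"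
    and F: "inj_on F (verts (subdivide L a b s))" "{u, w} \<inter> F ` verts (subdivide L a b s) = {}" "u \<noteq> w"
    and g: "inj_on g (edges (subdivide L a b s))"
    and def: "distinct [d, e, f]"
      "{d, e, f} \<inter> g ` (edges (subdivide L a b s) - {(x, i)}) = {}"
    and ends_g: "\<forall>z\<in>edges (subdivide L a b s) - {(x, i)}. en (g z) = F ` ends (subdivide L a b s) z"
    and ends_def: "en d = {F (sub_vertex a b s x i), u}" "en e = {u, w}"
      "en f = {w, F (sub_vertex a b s x (Suc i))}"
  defines "s' \<equiv> s(x := s x + 2)"
  shows "\<exists>F' g'. inj_on F' (verts (subdivide L a b s')) \<and>
    F' ` verts (subdivide L a b s') = F ` verts (subdivide L a b s) \<union> {u, w} \<and>
    inj_on g' (edges (subdivide L a b s')) \<and>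
    g' ` edges (subdivide L a b s') = g ` (edges (subdivide L a b s) - {(x, i)}) \<union> {d, e, f} \<and>
    (\<forall>z\<in>edges (subdivide L a b s'). en (g' z) = F' ` ends (subdivide L a b s') z)"
proof -
  let ?D = "subdivide L a b s" and ?D' = "subdivide L a b s'"
  \<comment> \<open>Position \<open>j\<close> of the longer path is sent back to its position in the
    old one. Injectivity fails only at positions \<open>i + 1\<close> and \<open>i + 2\<close>;
    these are the new vertices \<open>u\<close> and \<open>w\<close>, treated separately. Among the
    edges the positions \<open>i\<close>, \<open>i + 1\<close> and \<open>i + 2\<close> are all set
    aside, since the old edge \<open>(x, i)\<close> disappears.\<close>
  define shift where "shift y j = (if y = x \<and> j > i then j - 2 else j)" for y and j :: nat
  have shift_inj: "j = j'" if "shift y j = shift y j'"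
    "y = x \<Longrightarrow> j \<noteq> Suc i \<and> j \<noteq> Suc (Suc i)" "y = x \<Longrightarrow> j' \<noteq> Suc i \<and> j' \<noteq> Suc (Suc i)" for y j j'
    using that unfolding shift_def by (cases "y = x"; cases "j > i"; cases "j' > i") auto
  define pv :: "'w + 'f \<times> nat \<Rightarrow> 'w + 'f \<times> nat" where
    "pv z = (case z of Inl v \<Rightarrow> Inl v | Inr (y, j) \<Rightarrow> Inr (y, shift y j))" for z
  define pe :: "'f \<times> nat \<Rightarrow> 'f \<times> nat" where
    "pe z = (case z of (y, j) \<Rightarrow> (y, shift y j))" for z
  define F' where "F' z = (if z = Inr (x, i + 1) then u else if z = Inr (x, i + 2) then w else F (pv z))" for z
  define g' where "g' z = (if z = (x, i) then d else if z = (x, i + 1) then e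
    else if z = (x, i + 2) then f else g (pe z))" for z
  let ?V = "verts ?D' - {Inr (x, i + 1), Inr (x, i + 2)}" and ?E = "edges ?D' - {(x, i), (x, i + 1), (x, i + 2)}"
  have pv_inj: "inj_on pv ?V"
  proof (rule inj_onI)
    fix z z' assume "z \<in> ?V" "z' \<in> ?V" "pv z = pv z'"
    then show "z = z'"
      by (cases z; cases z'; cases "projr z"; cases "projr z'") (auto simp: pv_def dest: shift_inj)
  qed
  have pv_in: "pv z \<in> verts ?D" if "z \<in> ?V" for z
  proof (cases z)
    case (Inr p)
    obtain y j where p: "p = (y, j)" by (cases p)
    have "y = x \<longrightarrow> j \<noteq> i + 1 \<and> j \<noteq> i + 2" using that Inr p by auto
    then consider "y \<noteq> x" | "y = x" "j \<le> i" | "y = x" "j \<ge> i + 3" by linarith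
    then show ?thesis
      using that x by cases (auto simp: Inr p pv_def shift_def subdivide_sel s'_def)
  qed (use that in \<open>simp add: pv_def subdivide_sel\<close>)
  have pv_surj: "\<exists>z'\<in>?V. pv z' = z" if z: "z \<in> verts ?D" for z
  proof (cases z)
    case (Inl v)
    then show ?thesis using z by (intro bexI[of _ z]) (auto simp: pv_def shift_def subdivide_sel)
  next
    case (Inr p)
    obtain y j where p: "p = (y, j)" by (cases p)
    show ?thesis
    proof (cases "y = x \<and> j > i")
      case True
      then show ?thesis using z Inr p x
        by (intro bexI[of _ "Inr (x, j + 2)"]) (auto simp: pv_def shift_def subdivide_sel s'_def)
    next
      case False
      then show ?thesis using z Inr p
        by (intro bexI[of _ z]) (auto simp: pv_def shift_def subdivide_sel s'_def)
    qed
  qed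
  have pv_img: "pv ` ?V = verts ?D"
  proof
    show "pv ` ?V \<subseteq> verts ?D" using pv_in by (rule image_subsetI)
    show "verts ?D \<subseteq> pv ` ?V" using pv_surj by (metis imageI subsetI)
  qed
  have pe_inj: "inj_on pe ?E"
  proof (rule inj_onI)
    fix z z' assume "z \<in> ?E" "z' \<in> ?E" "pe z = pe z'"
    then show "z = z'"
      by (cases z; cases z') (auto simp: pe_def dest: shift_inj)
  qed
  have pe_in: "pe z \<in> edges ?D - {(x, i)}" if "z \<in> ?E" for z
    using that x by (cases z) (auto simp: pe_def shift_def subdivide_sel s'_def split: if_splits)
  have pe_surj: "\<exists>z'\<in>?E. pe z' = z" if z: "z \<in> edges ?D - {(x, i)}" for z
  proof -
    obtain y j where p: "z = (y, j)" by (cases z)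
    show ?thesis
    proof (cases "y = x \<and> j > i")
      case True
      then show ?thesis using z p x
        by (intro bexI[of _ "(x, j + 2)"]) (auto simp: pe_def shift_def subdivide_sel s'_def)
    next
      case False
      then show ?thesis using z p
        by (intro bexI[of _ z]) (auto simp: pe_def shift_def subdivide_sel s'_def)
    qed
  qed
  have pe_img: "pe ` ?E = edges ?D - {(x, i)}"
  proof
    show "pe ` ?E \<subseteq> edges ?D - {(x, i)}" using pe_in by (rule image_subsetI)
    show "edges ?D - {(x, i)} \<subseteq> pe ` ?E" using pe_surj by (metis imageI subsetI)
  qed
  have F'_V: "F' ` ?V = F ` verts ?D" unfolding pv_img[symmetric] image_image
    by (intro image_cong) (auto simp: F'_def)
  have V_eq: "verts ?D' = ?V \<union> {Inr (x, i + 1), Inr (x, i + 2)}"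
    using x by (auto simp: subdivide_sel s'_def)
  have F'_new: "F' (Inr (x, i + 1)) = u" "F' (Inr (x, i + 2)) = w" by (auto simp: F'_def)
  have img_F': "F' ` verts ?D' = F ` verts ?D \<union> {u, w}"
    by (subst V_eq) (simp only: image_Un F'_V image_insert image_empty F'_new)
  have "inj_on F' ?V"
  proof -
    have "inj_on (F \<circ> pv) ?V" using pv_inj F(1) pv_img by (intro comp_inj_on) auto
    then show ?thesis by (rule inj_on_cong[THEN iffD1, rotated]) (auto simp: F'_def)
  qed
  moreover have "F' ` {Inr (x, i + 1), Inr (x, i + 2)} = {u, w}" using F'_new by simp
  ultimately have "inj_on F' (?V \<union> {Inr (x, i + 1), Inr (x, i + 2)})"
    unfolding inj_on_Un using F(2,3) F'_V F'_new by (simp add: Diff_triv Int_commute)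
  then have inj_F': "inj_on F' (verts ?D')" by (simp only: V_eq[symmetric])
  have g'_E: "g' ` ?E = g ` (edges ?D - {(x, i)})" unfolding pe_img[symmetric] image_image
    by (intro image_cong) (auto simp: g'_def)
  have E_eq: "edges ?D' = ?E \<union> {(x, i), (x, i + 1), (x, i + 2)}"
    using x by (auto simp: subdivide_sel s'_def)
  have g'_new: "g' (x, i) = d" "g' (x, i + 1) = e" "g' (x, i + 2) = f" by (auto simp: g'_def)
  have img_g': "g' ` edges ?D' = g ` (edges ?D - {(x, i)}) \<union> {d, e, f}"
    by (subst E_eq) (simp only: image_Un g'_E image_insert image_empty g'_new)
  have "inj_on g' ?E"
  proof -
    have "inj_on (g \<circ> pe) ?E" using pe_inj g pe_img by (intro comp_inj_on) (auto intro: inj_on_subset)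
    then show ?thesis by (rule inj_on_cong[THEN iffD1, rotated]) (auto simp: g'_def)
  qed
  moreover have "g' ` {(x, i), (x, i + 1), (x, i + 2)} = {d, e, f}" using g'_new by simp
  ultimately have "inj_on g' (?E \<union> {(x, i), (x, i + 1), (x, i + 2)})"
    unfolding inj_on_Un using def g'_E g'_new by (simp add: Diff_triv Int_commute)
  then have inj_g': "inj_on g' (edges ?D')" by (simp only: E_eq[symmetric])
  have sv_other: "F' (sub_vertex a b s' y j) = F (sub_vertex a b s y j)" if "y \<noteq> x" for y j
    using that by (auto simp: F'_def s'_def sub_vertex_def pv_def shift_def)
  have sv_low: "F' (sub_vertex a b s' x j) = F (sub_vertex a b s x j)" if "j \<le> i" for j
    using that x by (auto simp: F'_def s'_def sub_vertex_def pv_def shift_def)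
  \<comment> \<open>This includes the final branch vertex, because the length of the path has grown
    by the same 2 as the position.\<close>
  have sv_high: "F' (sub_vertex a b s' x (j + 2)) = F (sub_vertex a b s x j)" if "j > i" for j
    using that x by (auto simp: F'_def s'_def sub_vertex_def pv_def shift_def)
  have sv_new: "F' (sub_vertex a b s' x (Suc i)) = u" "F' (sub_vertex a b s' x (Suc (Suc i))) = w"
    using x by (auto simp: F'_def s'_def sub_vertex_def)
  have ends_old: "en (g' z) = F ` ends ?D (pe z)" if "z \<in> ?E" for z
  proof -
    have "g' z = g (pe z)" using that by (auto simp: g'_def)
    then show ?thesis using bspec[OF ends_g pe_in[OF that]] by simp
  qed
  have ends_g': "en (g' z) = F' ` ends ?D' z" if z: "z \<in> edges ?D'" for z
  proof -
    obtain y j where p: "z = (y, j)" by (cases z)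
    consider "y \<noteq> x" | "y = x" "j < i" | "y = x" "j = i" | "y = x" "j = Suc i"
      | "y = x" "j = Suc (Suc i)" | "y = x" "Suc (Suc i) < j" by linarith
    then show ?thesis
    proof cases
      case 1
      then have "pe z = z" "z \<in> ?E" using p z by (auto simp: pe_def shift_def)
      then have "en (g' z) = F ` ends ?D z" using ends_old[of z] by simp
      then show ?thesis using sv_other[OF 1] by (simp add: p subdivide_sel)
    next
      case 2
      then have "pe z = z" "z \<in> ?E" using p z by (auto simp: pe_def shift_def)
      then have "en (g' z) = F ` ends ?D z" using ends_old[of z] by simp
      then show ?thesis using sv_low 2 by (simp add: p subdivide_sel)
    next
      case 3
      then show ?thesis using sv_low[of i] sv_new ends_def g'_new by (simp add: p subdivide_sel)
    next
      case 4
      then show ?thesis using sv_new ends_def g'_new by (simp add: p subdivide_sel)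
    next
      case 5
      then show ?thesis using sv_new sv_high[of "Suc i"] ends_def g'_new by (simp add: p subdivide_sel)
    next
      case 6
      define k where "k = j - 2"
      have 6: "y = x" "j = k + 2" "k > i" using 6 by (auto simp: k_def)
      then have "pe z = (x, k)" "z \<in> ?E" using p z by (auto simp: pe_def shift_def)
      then have "en (g' z) = F ` ends ?D (x, k)" using ends_old[of z] by simp
      then show ?thesis using sv_high[of k] sv_high[of "Suc k"] 6 by (simp add: p subdivide_sel)
    qed
  qed
  show ?thesis using inj_F' img_F' inj_g' img_g' ends_g' by blast
qed

context inner_edge
begin

text \<open>If the copy of \<open>L\<close> avoids \<open>d\<close>, it is kept and
  \<open>u\<close>, \<open>w\<close> join the matched remainder. If it uses \<open>d\<close>, the
  path through \<open>u\<close> and \<open>w\<close> takes the place of \<open>d\<close>, which adds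
  two subdivision vertices and so preserves parity.\<close>

lemma conformal_minor_shortcut_imp:
  assumes L: "graph L" and minor: "conformal_minor L shortcut"
  shows "conformal_minor L G"
proof -
  obtain \<alpha> \<beta> s F g where s: "\<forall>e\<in>edges L. ends L e = {\<alpha> e, \<beta> e} \<and> even (s e)"
    and Fg: "conformal_embedding (subdivide L \<alpha> \<beta> s) shortcut F g"
    using minor unfolding conformal_minor_iff_embedding[OF graph_shortcut L] by (elim exE conjE)
  let ?D = "subdivide L \<alpha> \<beta> s"
  note E = Fg[unfolded conformal_embedding_def]
  have uwF: "{u, w} \<inter> F ` verts ?D = {}" "F ` verts ?D \<subseteq> verts G" using E by (auto simp: shortcut_sel)
  have uwG: "u \<in> verts G" "w \<in> verts G" using ends_props(1)[OF G e(1)] e(2) by auto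
  have ends_g: "ends G (g z) = F ` ends ?D z" "ends G (g z) \<inter> {u, w} = {}" "g z \<in> edges G"
    if "z \<in> edges ?D" "g z \<noteq> d" for z
  proof -
    have "g z \<in> edges shortcut" using E that by blast
    then show "ends G (g z) \<inter> {u, w} = {}" "g z \<in> edges G" using that by (auto simp: shortcut_sel)
    show "ends G (g z) = F ` ends ?D z" using E that by (metis shortcut_sel(4))
  qed
  show ?thesis
  proof (cases "d \<in> g ` edges ?D")
    case False
    then have nd: "g z \<noteq> d" if "z \<in> edges ?D" for z using that by blast
    have "verts G - F ` verts ?D = (verts shortcut - F ` verts ?D) \<union> {u, w}"
      using uwF uwG by (auto simp: shortcut_sel)
    then have "matched G (verts G - F ` verts ?D)"
      using matched_shortcut_expand[of "verts shortcut - F ` verts ?D"] E by simp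
    moreover have "g ` edges ?D \<subseteq> edges G" using ends_g(3) nd by (simp add: image_subset_iff)
    moreover have "\<forall>z\<in>edges ?D. ends G (g z) = F ` ends ?D z" using ends_g(1) nd by simp
    ultimately have "conformal_embedding ?D G F g"
      unfolding conformal_embedding_def using E uwF(2) by simp
    then show ?thesis using s unfolding conformal_minor_iff_embedding[OF G L] by blast
  next
    case True
    then obtain x i where xi: "(x, i) \<in> edges ?D" "g (x, i) = d" by auto
    then have x: "x \<in> edges L" "i \<le> s x" by (auto simp: subdivide_sel)
    let ?p = "F (sub_vertex \<alpha> \<beta> s x i)" and ?q = "F (sub_vertex \<alpha> \<beta> s x (Suc i))"
    have "ends shortcut (g (x, i)) = F ` ends ?D (x, i)" using E xi(1) by blast
    then have pq: "{?p, ?q} = {a, b}" unfolding xi(2) shortcut_sel subdivide_sel by simp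
    have nd: "g z \<noteq> d" if "z \<in> edges ?D - {(x, i)}" for z
      using inj_onD[of g "edges ?D" z "(x, i)"] E xi that by auto
    have sv_ab: "\<forall>e\<in>edges L. ends L e = {\<alpha> e, \<beta> e}" using s by blast
    define s' where "s' = s(x := s x + 2)"
    let ?D' = "subdivide L \<alpha> \<beta> s'"
    have s': "\<forall>e\<in>edges L. ends L e = {\<alpha> e, \<beta> e} \<and> even (s' e)" using s unfolding s'_def by auto
    \<comment> \<open>The subdivided edge may run through \<open>d\<close> from \<open>a\<close> to
      \<open>b\<close> or from \<open>b\<close> to \<open>a\<close>. The primed names stand for the
      path in the direction of traversal, so that both cases are treated at once.\<close>
    have key: ?thesis if or: "{u', w'} = {u, w}" "{d', f'} = {d, f}"
      "ends G d' = {?p, u'}" "ends G f' = {w', ?q}" for u' w' d' f'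
    proof -
      have def: "distinct [d', e, f']" "u' \<noteq> w'" 
        using or(1,2) distinct_edges distinct_ends by (auto simp: doubleton_eq_iff)
      have disj: "{d', e, f'} \<inter> g ` (edges ?D - {(x, i)}) = {}"
      proof -
        have "y \<notin> g ` (edges ?D - {(x, i)})" if y: "y \<in> {d', e, f'}" for y
        proof
          assume "y \<in> g ` (edges ?D - {(x, i)})"
          then obtain z where z: "y = g z" "z \<in> edges ?D - {(x, i)}" by (rule imageE)
          then have "ends G y \<inter> {u, w} = {}" using ends_g(2)[of z] nd[of z] by simp
          moreover have "y \<in> {d, e, f}" using y or(2) by (auto simp: doubleton_eq_iff)
          ultimately show False using d e f by auto
        qed
        then show ?thesis by blast
      qed
      have uw': "{u', w'} \<inter> F ` verts ?D = {}" "ends G e = {u', w'}" using or(1) uwF(1) e(2) by simp_all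
      have ends': "\<forall>z\<in>edges ?D - {(x, i)}. ends G (g z) = F ` ends ?D z"
        using ends_g(1) nd by blast
      have inj: "inj_on F (verts ?D)" "inj_on g (edges ?D)" using E by auto
      obtain F' g' where F': "inj_on F' (verts ?D')"
        "F' ` verts ?D' = F ` verts ?D \<union> {u', w'}" "inj_on g' (edges ?D')"
        "g' ` edges ?D' = g ` (edges ?D - {(x, i)}) \<union> {d', e, f'}"
        "\<forall>z\<in>edges ?D'. ends G (g' z) = F' ` ends ?D' z"
        unfolding s'_def
        using subdivide_embedding_extend[where L = L and a = \<alpha> and b = \<beta> and s = s and x = x and i = i
            and F = F and u = u' and w = w' and g = g and d = d' and e = e and f = f' and en = "ends G",
            OF L sv_ab x inj(1) uw'(1) def(2) inj(2) def(1) disj ends' or(3) uw'(2) or(4)]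
        by (elim exE conjE) simp
      have sv: "sub_vertex \<alpha> \<beta> s x j \<in> verts ?D" for j by (rule sub_vertex_in_verts[OF L sv_ab x(1)])
      \<comment> \<open>Since \<open>a\<close> lies in the copy, the matching of the remainder
        cannot use \<open>d\<close> and is already a matching in \<open>G\<close>.\<close>
      have "a \<in> F ` verts ?D" using pq sv[of i] sv[of "Suc i"] by (auto simp: doubleton_eq_iff)
      then have "matched G (verts shortcut - F ` verts ?D)"
        using E by (intro matched_shortcutD) auto
      moreover have "verts shortcut - F ` verts ?D = verts G - F' ` verts ?D'"
        unfolding F'(2) or(1) by (auto simp: shortcut_sel)
      ultimately have rest: "matched G (verts G - F' ` verts ?D')" by simp
      have "g' ` edges ?D' \<subseteq> edges G"
        unfolding F'(4) using ends_g(3) nd or(2) d e f by (auto simp: doubleton_eq_iff)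
      moreover have "F' ` verts ?D' \<subseteq> verts G" unfolding F'(2) or(1) using uwF(2) uwG by blast
      ultimately have "conformal_embedding ?D' G F' g'"
        unfolding conformal_embedding_def using F' rest by blast
      then show ?thesis using s' unfolding conformal_minor_iff_embedding[OF G L] by blast
    qed
    show ?thesis
    proof (cases "?p = a")
      case True
      then have "?q = b" using pq by (auto simp: doubleton_eq_iff)
      then show ?thesis using key[of u w d f] True d f by simp
    next
      case False
      then have "?p = b" "?q = a" using pq by (auto simp: doubleton_eq_iff)
      then show ?thesis using key[of w u f d] d f by (simp add: insert_commute)
    qed
  qed
qed

end

section \<open>Reducing an expansion to singletons and triangles\<close>

text \<open>The end of \<open>\<phi> e\<close> in \<open>S v\<close>; meaningful only if \<open>v\<close> is an end of \<open>e\<close>.\<close>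

definition attach :: "('v, 'e) mgraph \<Rightarrow> ('w \<Rightarrow> 'v set) \<Rightarrow> ('f \<Rightarrow> 'e) \<Rightarrow> 'w \<Rightarrow> 'f \<Rightarrow> 'v" where
  "attach G S \<phi> v e = the_elem (ends G (\<phi> e) \<inter> S v)"

lemma attach_eq:
  assumes "graph K" "graph G" "expansion K G S \<phi>" "e \<in> edges K" "v \<in> ends K e"
  shows "ends G (\<phi> e) \<inter> S v = {attach G S \<phi> v e}"
  using expansion_end_in[OF assms] by (metis attach_def the_elem_eq)

lemma attach_in:
  assumes "graph K" "graph G" "expansion K G S \<phi>" "e \<in> edges K" "v \<in> ends K e"
  shows "attach G S \<phi> v e \<in> S v" "attach G S \<phi> v e \<in> ends G (\<phi> e)"
  using attach_eq[OF assms] by auto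

lemma attach_matched:
  assumes "graph K" "graph G" "expansion K G S \<phi>" "e \<in> edges K" "v \<in> ends K e"
  shows "matched G (S v - {attach G S \<phi> v e})"
proof -
  have "S v - ends G (\<phi> e) = S v - {attach G S \<phi> v e}" using attach_eq[OF assms] by blast
  then show ?thesis using expansionD(7)[OF assms(3-5)] by simp
qed

lemma ends_eq_attach:
  assumes "graph K" "graph G" "expansion K G S \<phi>" "e \<in> edges K"
  shows "ends G (\<phi> e) = (\<lambda>v. attach G S \<phi> v e) ` ends K e"
proof -
  have "ends G (\<phi> e) = (\<Union>v\<in>ends K e. ends G (\<phi> e) \<inter> S v)"
    using expansionD(5)[OF assms(3,4)] by blast
  also have "\<dots> = (\<Union>v\<in>ends K e. {attach G S \<phi> v e})"
    using attach_eq[OF assms] by simp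
  finally show ?thesis by auto
qed

lemma not_incident_disjoint:
  assumes "graph K" "expansion K G S \<phi>" "e \<in> edges K" "v \<in> verts K" "v \<notin> ends K e"
  shows "ends G (\<phi> e) \<inter> S v = {}"
proof -
  have "S y \<inter> S v = {}" if "y \<in> ends K e" for y
    using expansionD(2)[OF assms(2), of y v] ends_props(1)[OF assms(1,3)] assms(4,5) that by blast
  then show ?thesis using expansionD(5)[OF assms(2,3)] by blast
qed

text \<open>This is the bookkeeping common to all reductions: the set \<open>U\<close>, later the
  ends of the shared edge, is taken away from \<open>S v\<close> alone. The graph \<open>G'\<close>
  is \<open>G\<close> itself or the graph after suppressing a path; edge names and all other sets
  are kept, so only the conditions at \<open>v\<close> and at the remainder need separate
  proof.\<close>

lemma expansion_shrink:
  assumes K: "graph K" and ex: "expansion K G S \<phi>" and v: "v \<in> verts K" and U: "U \<subseteq> S v" "U \<noteq> {}"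
    and G: "graph G" and verts': "verts G - U \<subseteq> verts G'"
    and mono: "\<And>A. matched G A \<Longrightarrow> A \<inter> U = {} \<Longrightarrow> matched G' A"
    and edges': "\<And>e. e \<in> edges K \<Longrightarrow> \<phi> e \<in> edges G'"
    and ends': "\<And>e. e \<in> edges K \<Longrightarrow> ends G' (\<phi> e) \<inter> U = {}"
      "\<And>e. e \<in> edges K \<Longrightarrow> ends G' (\<phi> e) \<subseteq> (\<Union>y\<in>ends K e. S y)"
      "\<And>e. e \<in> edges K \<Longrightarrow> ends G' (\<phi> e) - S v = ends G (\<phi> e) - S v"
    and at_v: "\<And>e. e \<in> edges K \<Longrightarrow> v \<in> ends K e \<Longrightarrow> ends G' (\<phi> e) \<inter> S v \<noteq> {}"
      "\<And>e. e \<in> edges K \<Longrightarrow> v \<in> ends K e \<Longrightarrow> matched G' (S v - U - ends G' (\<phi> e))"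
    and rest: "matched G' (verts G' - ((\<Union>y\<in>verts K. S y) - U))"
  defines "S' \<equiv> S(v := S v - U)"
  shows "expansion K G' S' \<phi>" "card (\<Union>y\<in>verts K. S' y) < card (\<Union>y\<in>verts K. S y)"
proof -
  note D = expansionD[OF ex]
  have disjU: "S y \<inter> U = {}" if "y \<in> verts K" "y \<noteq> v" for y
    using D(2)[OF that(1) v that(2)] U by blast
  have S'_eq: "S' y = S y - U" if "y \<in> verts K" for y
    using disjU[OF that] unfolding S'_def by auto
  have UN_S': "(\<Union>y\<in>verts K. S' y) = (\<Union>y\<in>verts K. S y) - U" using S'_eq by auto
  have "finite (\<Union>y\<in>verts K. S y)"
    using D(1) G unfolding graph_def by (meson UN_least finite_subset)
  moreover have "(\<Union>y\<in>verts K. S y) - U \<subset> (\<Union>y\<in>verts K. S y)" using U v by blast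
  ultimately show "card (\<Union>y\<in>verts K. S' y) < card (\<Union>y\<in>verts K. S y)"
    unfolding UN_S' by (rule psubset_card_mono)
  have other: "ends G' (\<phi> e) \<inter> S y = ends G (\<phi> e) \<inter> S y"
    if "e \<in> edges K" "y \<in> verts K" "y \<noteq> v" for e y
    using ends'(3)[OF that(1)] D(2)[OF that(2) v that(3)] by blast
  have in_K: "y \<in> verts K" if "e \<in> edges K" "y \<in> ends K e" for e y
    using ends_props(1)[OF K that(1)] that(2) by blast
  show "expansion K G' S' \<phi>"
    unfolding expansion_def
  proof (intro conjI ballI impI)
    fix y assume y: "y \<in> verts K"
    then show "S' y \<subseteq> verts G'" using S'_eq[OF y] D(1)[OF y] verts' by blast
    fix z assume "z \<in> verts K" "y \<noteq> z"
    then show "S' y \<inter> S' z = {}" using S'_eq y D(2)[of y z] by blast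
  next
    show "\<phi> ` edges K \<subseteq> edges G'" using edges' by blast
    show "inj_on \<phi> (edges K)" by (rule D(4))
    show "matched G' (verts G' - (\<Union>y\<in>verts K. S' y))" unfolding UN_S' by (rule rest)
  next
    fix e assume e: "e \<in> edges K"
    have UN_ends: "(\<Union>y\<in>ends K e. S' y) = (\<Union>y\<in>ends K e. S y) - U" using S'_eq in_K[OF e] by auto
    show "ends G' (\<phi> e) \<subseteq> (\<Union>y\<in>ends K e. S' y)"
      unfolding UN_ends using ends'(1,2)[OF e] by blast
    fix y assume y: "y \<in> ends K e"
    have yK: "y \<in> verts K" by (rule in_K[OF e y])
    have "ends G' (\<phi> e) \<inter> S y \<noteq> {}"
      using at_v(1)[OF e] other[OF e yK] D(6)[OF e y] y by (cases "y = v") auto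
    then show "ends G' (\<phi> e) \<inter> S' y \<noteq> {}" using ends'(1)[OF e] S'_eq[OF yK] by blast
    show "matched G' (S' y - ends G' (\<phi> e))"
    proof (cases "y = v")
      case True
      then show ?thesis using at_v(2)[OF e] y S'_eq[OF yK] by simp
    next
      case False
      have "S' y - ends G' (\<phi> e) = S y - ends G (\<phi> e)"
        using other[OF e yK False] S'_eq[OF yK] disjU[OF yK False] by blast
      moreover have "(S y - ends G (\<phi> e)) \<inter> U = {}" using disjU[OF yK False] by blast
      ultimately show ?thesis using mono[OF D(7)[OF e y]] by simp
    qed
  qed
qed

text \<open>Removing the ends of the shared edge \<open>e\<close> from \<open>S v\<close> leaves the
  first two ends as removable as before. The cases below differ in how the third end is kept
  removable: \<open>e\<close> may avoid its attachment vertex \<open>x3\<close> or contain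
  it.\<close>

lemma expansion_reduce:
  fixes G :: "('v, 'e) mgraph" and S :: "'w \<Rightarrow> 'v set"
  assumes J: "graph J" and G: "graph G" and ex: "expansion J G S \<phi>" and v: "v \<in> verts J"
    and inc: "{x \<in> edges J. v \<in> ends J x} = {e1, e2, e3}"
    and shared: "shared_edge G (S v) (attach G S \<phi> v e1) (attach G S \<phi> v e2)"
  shows "\<exists>(G' :: ('v, 'e) mgraph) S'. graph G' \<and> expansion J G' S' \<phi> \<and>
    card (\<Union>y\<in>verts J. S' y) < card (\<Union>y\<in>verts J. S y) \<and>
    (\<forall>L :: ('c, 'd) mgraph. graph L \<longrightarrow> conformal_minor L G' \<longrightarrow> conformal_minor L G)"
proof -
  have witness: ?thesis if "graph G'" "expansion J G' S' \<phi>"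
    "card (\<Union>y\<in>verts J. S' y) < card (\<Union>y\<in>verts J. S y)"
    "\<And>L :: ('c, 'd) mgraph. graph L \<Longrightarrow> conformal_minor L G' \<Longrightarrow> conformal_minor L G"
    for G' :: "('v, 'e) mgraph" and S'
    using that by blast
  note D = expansionD[OF ex]
  let ?at = "attach G S \<phi> v"
  have e_in: "x \<in> edges J" "v \<in> ends J x" if "x \<in> {e1, e2, e3}" for x using inc that by blast+
  have inc': "x \<in> {e1, e2, e3}" if "x \<in> edges J" "v \<in> ends J x" for x using inc that by blast
  have at: "ends G (\<phi> x) \<inter> S v = {?at x}" if "x \<in> {e1, e2, e3}" for x
    using attach_eq[OF J G ex e_in[OF that]] .
  define x3 where "x3 = ?at e3"
  have x3: "x3 \<in> S v" "x3 \<in> ends G (\<phi> e3)" "matched G (S v - {x3})"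
    unfolding x3_def using attach_in[OF J G ex e_in] attach_matched[OF J G ex e_in] by auto
  have at3: "ends G (\<phi> e3) \<inter> S v = {x3}" using at[of e3] by (simp add: x3_def)
  obtain e where e: "e \<in> edges G" "ends G e \<subseteq> S v - {?at e1, ?at e2}"
    "matched G (S v - {?at e1} - ends G e)" "matched G (S v - {?at e2} - ends G e)"
    using shared unfolding shared_edge_def by blast
  have rest_eq: "verts G - ends G e - ((\<Union>y\<in>verts J. S y) - ends G e) = verts G - (\<Union>y\<in>verts J. S y)"
    using e(2) v by blast
  have restU: "(verts G - (\<Union>y\<in>verts J. S y)) \<inter> ends G e = {}" using e(2) v by blast
  have off12: "ends G (\<phi> x) \<inter> ends G e = {}" if "x \<in> edges J" "x \<noteq> e3" for x
  proof (cases "v \<in> ends J x")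
    case True
    then have "x \<in> {e1, e2}" using inc'[OF that(1)] that(2) by blast
    then show ?thesis using at[of x] e(2) by auto
  next
    case False
    then show ?thesis using not_incident_disjoint[OF J ex that(1) v] e(2) by blast
  qed
  have m12: "matched G (S v - ends G e - ends G (\<phi> x))" if "x \<in> {e1, e2}" for x
  proof -
    have "S v - ends G e - ends G (\<phi> x) = S v - {?at x} - ends G e" using at[of x] that by blast
    then show ?thesis using e(3,4) that by auto
  qed
  show ?thesis
  proof (cases "x3 \<in> ends G e")
    case False
    then have off: "ends G (\<phi> x) \<inter> ends G e = {}" if "x \<in> edges J" for x
    proof (cases "x = e3")
      case True
      have "ends G (\<phi> e3) \<inter> ends G e \<subseteq> ends G (\<phi> e3) \<inter> S v" using e(2) by blast
      then have "ends G (\<phi> e3) \<inter> ends G e \<subseteq> {x3}" unfolding at3 .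
      then show ?thesis using True \<open>x3 \<notin> ends G e\<close> by auto
    qed (rule off12[OF that])
    obtain u where "u \<in> ends G e" using ends_props(4)[OF G e(1)] by blast
    then obtain w where uw: "ends G e = {u, w}" "u \<noteq> w" using ends_eq_pair[OF G e(1)] by blast
    have uS: "u \<in> S v - {x3}" "w \<in> S v - {x3}" using uw e(2) False by auto
    obtain d where d: "d \<in> edges G" "u \<in> ends G d" "ends G d \<subseteq> S v - {x3}"
      "matched G (S v - {x3} - ends G d)" using matched_remove_edge[OF x3(3) uS(1)] by blast
    obtain a where a: "ends G d = {u, a}" "u \<noteq> a" by (rule ends_eq_pair[OF G d(1,2)])
    show ?thesis
    proof (cases "a = w")
      case True
      \<comment> \<open>Here \<open>d\<close> has the same ends as \<open>e\<close>, so nothing is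
        suppressed: the third matching loses \<open>d\<close>, and the two vertices pass to the
        remainder of \<open>G\<close>, matched there by \<open>e\<close>.\<close>
      have m3: "matched G (S v - ends G e - ends G (\<phi> e3))"
      proof -
        have "S v - ends G e - ends G (\<phi> e3) = S v - {x3} - ends G d"
          using at[of e3] a uw True unfolding x3_def by auto
        then show ?thesis using d(4) by simp
      qed
      have "verts G - ((\<Union>y\<in>verts J. S y) - ends G e) = (verts G - (\<Union>y\<in>verts J. S y)) \<union> ends G e"
        using ends_props(1)[OF G e(1)] by blast
      then have rest: "matched G (verts G - ((\<Union>y\<in>verts J. S y) - ends G e))"
        using matched_Un[OF matched_edge[OF e(1)] D(8)] restU by simp
      have at_v: "matched G (S v - ends G e - ends G (\<phi> x))" if "x \<in> edges J" "v \<in> ends J x" for x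
        using inc'[OF that] m12[of x] m3 by auto
      have "ends G e \<subseteq> S v" "ends G e \<noteq> {}" using e(2) uw by auto
      note shrink = expansion_shrink[OF J ex v this G _ _ D(3) off D(5) _ D(6) at_v rest]
      show ?thesis
        by (rule witness[OF G shrink]) auto
    next
      case aw: False
      then have wS: "w \<in> S v - {x3} - ends G d" using uS(2) a uw by auto
      obtain f where f: "f \<in> edges G" "w \<in> ends G f" "ends G f \<subseteq> S v - {x3} - ends G d"
        "matched G (S v - {x3} - ends G d - ends G f)"
        by (rule matched_remove_edge[OF d(4) wS])
      obtain b where b: "ends G f = {w, b}" "w \<noteq> b" by (rule ends_eq_pair[OF G f(1,2)])
      interpret ie: inner_edge G e d f u w a b
        using G e(1) uw d(1) a f b aw by unfold_locales auto
      have \<phi>d: "\<phi> x \<noteq> d" if "x \<in> edges J" for x using off[OF that] a uw by auto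
      have same: "ends ie.shortcut (\<phi> x) = ends G (\<phi> x)" if "x \<in> edges J" for x
        using \<phi>d[OF that] by (rule ie.shortcut_sel(4))
      have \<phi>_in: "\<phi> x \<in> edges ie.shortcut" if "x \<in> edges J" for x
        using off[OF that] D(3)[OF that] uw by (simp add: ie.shortcut_sel)
      have mono: "matched ie.shortcut A" if "matched G A" "A \<inter> ends G e = {}" for A
        using ie.matched_shortcutI that uw by simp
      \<comment> \<open>The edges \<open>d\<close> and \<open>f\<close> of the third matching merge
        into the suppressed edge from \<open>a\<close> to \<open>b\<close>.\<close>
      have "matched ie.shortcut ((S v - {x3} - ends G d - ends G f) \<union> ends ie.shortcut d)"
        using f(4) a b by (intro matched_insert mono) (auto simp: ie.shortcut_sel uw)
      moreover have "(S v - {x3} - ends G d - ends G f) \<union> ends ie.shortcut d = S v - ends G e - ends G (\<phi> e3)"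
      proof -
        have "S v - ends G e - ends G (\<phi> e3) = S v - ends G e - {x3}"
          using at[of e3] unfolding x3_def by blast
        then show ?thesis using a b d(3) f(3) uw ie.ab by (auto simp: ie.shortcut_sel)
      qed
      ultimately have m3: "matched ie.shortcut (S v - ends G e - ends G (\<phi> e3))" by simp
      have at_v: "matched ie.shortcut (S v - ends G e - ends ie.shortcut (\<phi> x))"
        if "x \<in> edges J" "v \<in> ends J x" for x
        using inc'[OF that] m3 mono[OF m12] same[OF that(1)] by auto
      have rest: "matched ie.shortcut (verts ie.shortcut - ((\<Union>y\<in>verts J. S y) - ends G e))"
        using mono[OF D(8) restU] rest_eq uw by (simp add: ie.shortcut_sel)
      have U: "ends G e \<subseteq> S v" "ends G e \<noteq> {}" using e(2) uw by auto
      have V: "verts G - ends G e \<subseteq> verts ie.shortcut" using uw by (simp add: ie.shortcut_sel)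
      note shrink = expansion_shrink[OF J ex v U G V mono \<phi>_in _ _ _ _ at_v rest, simplified same]
      show ?thesis
        by (rule witness[OF ie.graph_shortcut shrink ie.conformal_minor_shortcut_imp])
          (use off D(5,6) in auto)
    qed
  next
    case True
    obtain w where uw: "ends G e = {x3, w}" "x3 \<noteq> w" by (rule ends_eq_pair[OF G e(1) True])
    have e3: "e3 \<in> edges J" "v \<in> ends J e3" using e_in by auto
    \<comment> \<open>The edge \<open>e\<close> starts at \<open>x3\<close>, so the path to be
      suppressed begins outside \<open>S v\<close> with \<open>\<phi> e3\<close>. The suppressed
      edge keeps the name \<open>d\<close>, hence \<open>\<phi>\<close> need not change; only the
      attachment of \<open>e3\<close> moves from \<open>x3\<close> to \<open>b\<close>.\<close>
    define d where "d = \<phi> e3"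
    have d: "d \<in> edges G" "x3 \<in> ends G d" using D(3)[OF e3(1)] x3(2) by (auto simp: d_def)
    obtain a where a: "ends G d = {x3, a}" "x3 \<noteq> a" by (rule ends_eq_pair[OF G d])
    have aS: "a \<notin> S v" using at[of e3] a unfolding x3_def[symmetric] d_def by auto
    have wS: "w \<in> S v - {x3}" using uw e(2) by auto
    obtain f where f: "f \<in> edges G" "w \<in> ends G f" "ends G f \<subseteq> S v - {x3}"
      "matched G (S v - {x3} - ends G f)" using matched_remove_edge[OF x3(3) wS] by blast
    obtain b where b: "ends G f = {w, b}" "w \<noteq> b" by (rule ends_eq_pair[OF G f(1,2)])
    interpret ie: inner_edge G e d f x3 w a b
      using G e(1) uw d(1) a f b aS wS by unfold_locales auto
    have \<phi>d: "\<phi> x \<noteq> d" if "x \<in> edges J" "x \<noteq> e3" for x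
      using inj_onD[OF D(4)] e3 that unfolding d_def by blast
    have same: "ends ie.shortcut (\<phi> x) = ends G (\<phi> x)" if "x \<in> edges J" "x \<noteq> e3" for x
      using \<phi>d[OF that] by (rule ie.shortcut_sel(4))
    have ends3: "ends ie.shortcut (\<phi> e3) = {a, b}" using ie.shortcut_sel(3) by (simp add: d_def)
    have \<phi>_in: "\<phi> x \<in> edges ie.shortcut" if "x \<in> edges J" for x
      using off12[OF that] D(3)[OF that] uw by (cases "x = e3") (auto simp: ie.shortcut_sel simp flip: d_def)
    have mono: "matched ie.shortcut A" if "matched G A" "A \<inter> ends G e = {}" for A
      using ie.matched_shortcutI that uw by simp
    have bS: "b \<in> S v" "b \<noteq> x3" using f(3) b by auto
    \<comment> \<open>With \<open>b\<close> as the new attachment vertex, the third matching simply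
      loses \<open>f\<close>.\<close>
    have "S v - ends G e - {a, b} = S v - {x3} - ends G f" using uw b aS by auto
    then have m3: "matched ie.shortcut (S v - ends G e - {a, b})"
      using f(4) uw b by (intro mono) auto
    have at_v: "matched ie.shortcut (S v - ends G e - ends ie.shortcut (\<phi> x))"
      if "x \<in> edges J" "v \<in> ends J x" for x
      using inc'[OF that] m3 ends3 mono[OF m12] same[OF that(1)] by (cases "x = e3") auto
    have rest: "matched ie.shortcut (verts ie.shortcut - ((\<Union>y\<in>verts J. S y) - ends G e))"
      using mono[OF D(8) restU] rest_eq uw by (simp add: ie.shortcut_sel)
    have U: "ends G e \<subseteq> S v" "ends G e \<noteq> {}" using e(2) uw by auto
    have V: "verts G - ends G e \<subseteq> verts ie.shortcut" using uw by (simp add: ie.shortcut_sel)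
    have off': "ends ie.shortcut (\<phi> x) \<inter> ends G e = {}" if "x \<in> edges J" for x
      using off12[OF that] same[OF that] ends3 uw aS bS b wS x3(1) by (cases "x = e3") auto
    have sub': "ends ie.shortcut (\<phi> x) \<subseteq> (\<Union>y\<in>ends J x. S y)" if "x \<in> edges J" for x
      using D(5)[OF that] same[OF that] ends3 e3 bS a unfolding d_def by (cases "x = e3") auto
    have diff': "ends ie.shortcut (\<phi> x) - S v = ends G (\<phi> x) - S v" if "x \<in> edges J" for x
      using same[OF that] ends3 bS a x3(1) unfolding d_def by (cases "x = e3") auto
    have meet': "ends ie.shortcut (\<phi> x) \<inter> S v \<noteq> {}" if "x \<in> edges J" "v \<in> ends J x" for x
      using same[OF that(1)] D(6)[OF that] ends3 bS by (cases "x = e3") auto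
    note shrink = expansion_shrink[OF J ex v U G V mono \<phi>_in off' sub' diff' meet' at_v rest]
    show ?thesis by (rule witness[OF ie.graph_shortcut shrink ie.conformal_minor_shortcut_imp])
  qed
qed

section \<open>From singletons and triangles to a splicing\<close>

lemma conformal_embedding_imp_minor:
  assumes L: "graph L" and G: "graph G" and emb: "conformal_embedding L G f g"
  shows "conformal_minor L G"
proof -
  note E = emb[unfolded conformal_embedding_def]
  have "\<forall>e\<in>edges L. \<exists>a b. ends L e = {a, b}"
    using ends_props(2)[OF L] by (force simp: card_2_iff)
  then obtain a b where ab: "\<forall>e\<in>edges L. ends L e = {a e, b e}" by metis
  let ?s = "\<lambda>_ :: 'b. 0 :: nat"
  let ?D = "subdivide L a b ?s"
  have V: "verts ?D = Inl ` verts L" by (auto simp: subdivide_def)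
  have Ed: "edges ?D = (\<lambda>e. (e, 0)) ` edges L" by (auto simp: subdivide_def)
  have "conformal_embedding ?D G (f \<circ> projl) (g \<circ> fst)"
    unfolding conformal_embedding_def V Ed using E ab
    by (auto simp: inj_on_def image_image subdivide_sel sub_vertex_def)
  moreover have "\<forall>e\<in>edges L. ends L e = {a e, b e} \<and> even (?s e)" using ab by simp
  ultimately show ?thesis
    unfolding conformal_minor_iff_embedding[OF G L] by metis
qed

text \<open>On a singleton the three attachment vertices coincide and give a plain vertex of
  \<open>J\<close>. On a triangle they are distinct and label its vertices by the edges attached
  there, which is how \<open>splice_K4\<close> names them.\<close>

lemma expansion_triangles_imp_minor:
  fixes J :: "('a, 'b) mgraph"
  assumes J: "graph J" and G: "graph G" and ex: "expansion J G S \<phi>" and T: "T \<subseteq> verts J"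
    and single: "\<And>v. v \<in> verts J - T \<Longrightarrow> \<exists>x. S v = {x}"
    and triangle: "\<And>v. v \<in> T \<Longrightarrow> S v = attach G S \<phi> v ` {e \<in> edges J. v \<in> ends J e}"
      "\<And>v. v \<in> T \<Longrightarrow> inj_on (attach G S \<phi> v) {e \<in> edges J. v \<in> ends J e}"
      "\<And>v e e'. v \<in> T \<Longrightarrow> e \<noteq> e' \<Longrightarrow> e \<in> edges J \<Longrightarrow> v \<in> ends J e \<Longrightarrow> e' \<in> edges J \<Longrightarrow>
        v \<in> ends J e' \<Longrightarrow> \<exists>h\<in>edges G. ends G h = {attach G S \<phi> v e, attach G S \<phi> v e'}"
  shows "conformal_minor (splice_K4 J T) G"
proof -
  let ?at = "attach G S \<phi>" and ?P = "splice_K4 J T"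
  note D = expansionD[OF ex]
  define f where "f z = (case z of Inl v \<Rightarrow> the_elem (S v) | Inr (v, e) \<Rightarrow> ?at v e)" for z
  \<comment> \<open>An edge of a triangle is chosen for each pair; parallel edges of
    \<open>G\<close> may offer a choice.\<close>
  define g where "g z = (case z of Inl e \<Rightarrow> \<phi> e
    | Inr (v, P) \<Rightarrow> SOME h. h \<in> edges G \<and> ends G h = ?at v ` P)" for z
  define base where "base z = (case z of Inl v \<Rightarrow> v | Inr (v, e) \<Rightarrow> v)" for z :: "'a + 'a \<times> 'b"
  have verts_P: "z \<in> verts ?P \<longleftrightarrow> (\<exists>v. z = Inl v \<and> v \<in> verts J - T) \<or>
      (\<exists>v e. z = Inr (v, e) \<and> v \<in> T \<and> e \<in> edges J \<and> v \<in> ends J e)" for z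
    by (auto simp: splice_K4_def)
  have f_Inl: "S v = {f (Inl v)}" if v: "v \<in> verts J - T" for v
  proof -
    obtain x where "S v = {x}" using single[OF v] by blast
    then show ?thesis by (simp add: f_def)
  qed
  have at_S: "?at v e \<in> S v" if "e \<in> edges J" "v \<in> ends J e" for v e
    using attach_in[OF J G ex that] by blast
  have f_in: "f z \<in> S (base z)" "base z \<in> verts J" if "z \<in> verts ?P" for z
  proof -
    have "f (Inl v) \<in> S v" if "v \<in> verts J - T" for v using f_Inl[OF that] by blast
    moreover have "f (Inr p) = ?at (fst p) (snd p)" for p by (simp add: f_def split_beta)
    ultimately show "f z \<in> S (base z)" "base z \<in> verts J"
      using that T at_S unfolding verts_P by (auto simp: base_def)
  qed
  have inj_f: "inj_on f (verts ?P)"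
  proof (rule inj_onI)
    fix z z' assume z: "z \<in> verts ?P" "z' \<in> verts ?P" "f z = f z'"
    have "base z = base z'" using f_in[OF z(1)] f_in[OF z(2)] z(3) D(2)[of "base z" "base z'"]
      by (metis IntI emptyE)
    then show "z = z'"
      using z inj_onD[OF triangle(2)] unfolding verts_P by (auto simp: base_def f_def)
  qed
  have img_f: "f ` verts ?P = (\<Union>v\<in>verts J. S v)"
  proof
    show "f ` verts ?P \<subseteq> (\<Union>v\<in>verts J. S v)" using f_in by blast
    show "(\<Union>v\<in>verts J. S v) \<subseteq> f ` verts ?P"
    proof
      fix x assume "x \<in> (\<Union>v\<in>verts J. S v)"
      then obtain v where v: "v \<in> verts J" "x \<in> S v" by blast
      show "x \<in> f ` verts ?P"
      proof (cases "v \<in> T")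
        case True
        then obtain e where "e \<in> edges J" "v \<in> ends J e" "x = f (Inr (v, e))"
          using triangle(1)[OF True] v by (auto simp: f_def)
        then show ?thesis using True verts_P by blast
      next
        case False
        then show ?thesis using f_Inl[of v] v verts_P by blast
      qed
    qed
  qed
  have edges_P: "z \<in> edges ?P \<longleftrightarrow> (\<exists>e\<in>edges J. z = Inl e) \<or>
      (\<exists>v e e'. z = Inr (v, {e, e'}) \<and> v \<in> T \<and> e \<noteq> e' \<and>
        e \<in> edges J \<and> v \<in> ends J e \<and> e' \<in> edges J \<and> v \<in> ends J e')" for z
    by (auto simp: splice_K4_def)
  have g_Inr: "g (Inr (v, {e, e'})) \<in> edges G" "ends G (g (Inr (v, {e, e'}))) = {?at v e, ?at v e'}"
    if "v \<in> T" "e \<noteq> e'" "e \<in> edges J" "v \<in> ends J e" "e' \<in> edges J" "v \<in> ends J e'" for v e e'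
  proof -
    have "\<exists>h. h \<in> edges G \<and> ends G h = ?at v ` {e, e'}" using triangle(3)[OF that] by auto
    from someI_ex[OF this] show "g (Inr (v, {e, e'})) \<in> edges G"
      "ends G (g (Inr (v, {e, e'}))) = {?at v e, ?at v e'}" by (simp_all add: g_def)
  qed
  have g_in: "g z \<in> edges G" if "z \<in> edges ?P" for z
    using that D(3) g_Inr(1) unfolding edges_P by (auto simp: g_def)
  have splice: "f (splice_vertex T e v) = ?at v e" if "e \<in> edges J" "v \<in> ends J e" for e v
  proof (cases "v \<in> T")
    case False
    then have "S v = {f (Inl v)}" using f_Inl ends_props(1)[OF J that(1)] that(2) by blast
    then show ?thesis using at_S[OF that] False by (simp add: splice_vertex_def)
  qed (simp add: splice_vertex_def f_def)
  have ends_g: "ends G (g z) = f ` ends ?P z" if "z \<in> edges ?P" for z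
    using that unfolding edges_P
  proof (elim disjE bexE exE conjE)
    fix e assume e: "e \<in> edges J" "z = Inl e"
    have "ends G (\<phi> e) = (\<lambda>v. ?at v e) ` ends J e" by (rule ends_eq_attach[OF J G ex e(1)])
    also have "\<dots> = f ` splice_vertex T e ` ends J e"
      unfolding image_image using splice[OF e(1)] by (intro image_cong) auto
    finally show ?thesis using e by (simp add: g_def splice_K4_def)
  next
    fix v e e' assume z: "z = Inr (v, {e, e'})" and ve: "v \<in> T" "e \<noteq> e'" "e \<in> edges J"
      "v \<in> ends J e" "e' \<in> edges J" "v \<in> ends J e'"
    then show ?thesis using g_Inr(2)[OF ve] by (simp add: splice_K4_def f_def)
  qed
  have inner: "ends G (g (Inr (v, P))) \<subseteq> S v" "ends G (g (Inr (v, P))) = ?at v ` P"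
      "P \<subseteq> {e \<in> edges J. v \<in> ends J e}" "v \<in> T" "P \<noteq> {}"
    if "Inr (v, P) \<in> edges ?P" for v P
    using that g_Inr(2)[of v] at_S unfolding edges_P by auto
  have outer: "\<not> ends G (\<phi> e) \<subseteq> S v" if e: "e \<in> edges J" and v: "v \<in> verts J" for e v
  proof
    assume sub: "ends G (\<phi> e) \<subseteq> S v"
    obtain y where "y \<in> ends J e" using ends_props(4)[OF J e] by blast
    then obtain y' where "ends J e = {y, y'}" "y \<noteq> y'" using ends_eq_pair[OF J e] by blast
    then obtain y where y: "y \<in> ends J e" "y \<noteq> v" by blast
    then have "S y \<inter> S v = {}" using D(2)[of y v] ends_props(1)[OF J e] v by blast
    then show False using D(6)[OF e y(1)] sub by blast
  qed
  have inj_g: "inj_on g (edges ?P)"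
  proof (rule inj_onI)
    fix z z' assume z: "z \<in> edges ?P" "z' \<in> edges ?P" "g z = g z'"
    \<comment> \<open>The image of an edge of \<open>J\<close> meets two of the sets, whereas an
      edge of a triangle stays within one.\<close>
    have Inl_Inr: False if "Inl e \<in> edges ?P" "Inr p \<in> edges ?P" "g (Inl e) = g (Inr p)" for e p
    proof -
      obtain v P where p: "p = (v, P)" by (cases p)
      have "e \<in> edges J" using that(1) by (auto simp: splice_K4_def)
      then show False
        using outer[of e v] inner(1,4)[of v P] that T unfolding p by (auto simp: g_def)
    qed
    show "z = z'"
    proof (cases z; cases z')
      fix e e' assume "z = Inl e" "z' = Inl e'"
      then show ?thesis using z inj_onD[OF D(4)] by (auto simp: g_def splice_K4_def)
    next
      fix p q assume pq: "z = Inr p" "z' = Inr q"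
      obtain v P v' P' where p: "p = (v, P)" "q = (v', P')" by (cases p; cases q)
      note i = inner[OF z(1)[unfolded pq p]] inner[OF z(2)[unfolded pq p]]
      have eq: "?at v ` P = ?at v' ` P'" using i z(3) pq p by simp
      have "v = v'"
      proof (rule ccontr)
        assume "v \<noteq> v'"
        then have "S v \<inter> S v' = {}" using D(2)[of v v'] i T by blast
        moreover have "?at v ` P \<subseteq> S v" "?at v' ` P' \<subseteq> S v'" using i by auto
        then have "?at v ` P \<subseteq> S v \<inter> S v'" using eq by simp
        ultimately show False using i(5) by simp
      qed
      then have "P = P'"
        using eq inj_on_image_eq_iff[OF triangle(2)[OF i(4)] i(3), of P'] i(8) by simp
      then show ?thesis using \<open>v = v'\<close> pq p by simp
    qed (use z in \<open>metis Inl_Inr\<close>)+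
  qed
  have "conformal_embedding ?P G f g"
    unfolding conformal_embedding_def
  proof (intro conjI)
    show "f ` verts ?P \<subseteq> verts G" unfolding img_f using D(1) by blast
    show "matched G (verts G - f ` verts ?P)" unfolding img_f by (rule D(8))
  qed (use inj_f inj_g g_in ends_g in auto)
  then show ?thesis by (rule conformal_embedding_imp_minor[OF graph_splice_K4[OF J] G])
qed

text \<open>The induction generalises over \<open>G\<close> and \<open>S\<close> but not over
  \<open>\<phi>\<close>, because reductions keep the names of edges. \<open>T\<close> is read off
  only when no reduction is possible, so it has no relation to the splicing from which the expansion
  came.\<close>

lemma expansion_imp_splice_minor:
  fixes J :: "('a, 'b) mgraph" and G :: "('v, 'e) mgraph"
  assumes J: "graph J" "cubic J" "\<And>v. v \<in> verts J \<Longrightarrow> \<exists>e\<in>edges J. v \<in> ends J e"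
    and "graph G" "expansion J G S \<phi>"
  shows "\<exists>T\<subseteq>verts J. conformal_minor (splice_K4 J T) G"
  using assms(4-)
proof (induction "card (\<Union>v\<in>verts J. S v)" arbitrary: G S rule: less_induct)
  case less
  note G = less.prems(1) and ex = less.prems(2)
  let ?at = "attach G S \<phi>"
  let ?red = "\<exists>v\<in>verts J. \<exists>e1 e2 e3. {x \<in> edges J. v \<in> ends J x} = {e1, e2, e3} \<and>
    shared_edge G (S v) (?at v e1) (?at v e2)"
  show ?case
  proof (cases ?red)
    case True
    then obtain v e1 e2 e3 where v: "v \<in> verts J" "{x \<in> edges J. v \<in> ends J x} = {e1, e2, e3}"
      "shared_edge G (S v) (?at v e1) (?at v e2)" by blast
    have "\<exists>(G' :: ('v, 'e) mgraph) S'. graph G' \<and> expansion J G' S' \<phi> \<and>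
        card (\<Union>y\<in>verts J. S' y) < card (\<Union>y\<in>verts J. S y) \<and>
        (\<forall>L :: ('a + 'a \<times> 'b, 'b + 'a \<times> 'b set) mgraph.
          graph L \<longrightarrow> conformal_minor L G' \<longrightarrow> conformal_minor L G)"
      by (rule expansion_reduce[OF J(1) G ex v])
    then obtain G' :: "('v, 'e) mgraph" and S' where G': "graph G'" "expansion J G' S' \<phi>"
      "card (\<Union>y\<in>verts J. S' y) < card (\<Union>y\<in>verts J. S y)"
      "\<forall>L :: ('a + 'a \<times> 'b, 'b + 'a \<times> 'b set) mgraph.
        graph L \<longrightarrow> conformal_minor L G' \<longrightarrow> conformal_minor L G"
      by (elim exE conjE)
    show ?thesis using less.hyps[OF G'(3,1,2)] G'(4) graph_splice_K4[OF J(1)] by blast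
  next
    case False
    define T where "T = {v \<in> verts J. \<nexists>x. S v = {x}}"
    have tri: "S v = ?at v ` {e \<in> edges J. v \<in> ends J e}"
      "inj_on (?at v) {e \<in> edges J. v \<in> ends J e}"
      "\<forall>e e'. e \<noteq> e' \<longrightarrow> e \<in> edges J \<longrightarrow> v \<in> ends J e \<longrightarrow> e' \<in> edges J \<longrightarrow>
        v \<in> ends J e' \<longrightarrow> (\<exists>h\<in>edges G. ends G h = {?at v e, ?at v e'})" if vT: "v \<in> T" for v
    proof -
      have v: "v \<in> verts J" "\<nexists>x. S v = {x}" using vT by (auto simp: T_def)
      obtain e1 where e1: "e1 \<in> edges J" "v \<in> ends J e1" using J(3)[OF v(1)] by blast
      obtain e2 e3 where inc: "{x \<in> edges J. v \<in> ends J x} = {e1, e2, e3}" "distinct [e1, e2, e3]"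
        by (rule cubic_incident_edges[OF J(2) v(1) e1])
      have e: "x \<in> edges J" "v \<in> ends J x" if "x \<in> {e1, e2, e3}" for x using inc that by blast+
      have fin: "finite (S v)"
        using expansionD(1)[OF ex v(1)] G by (auto simp: graph_def intro: finite_subset)
      note at = attach_in(1)[OF J(1) G ex e] attach_matched[OF J(1) G ex e]
      \<comment> \<open>A reduction concerns the first two edges in a listing of those at
        \<open>v\<close>; permuted listings cover the other two pairs.\<close>
      have inc': "{x \<in> edges J. v \<in> ends J x} = {e1, e3, e2}" "{x \<in> edges J. v \<in> ends J x} = {e2, e3, e1}"
        using inc by auto
      have nosh: "\<not> shared_edge G (S v) (?at v e1) (?at v e2)" "\<not> shared_edge G (S v) (?at v e1) (?at v e3)"
        "\<not> shared_edge G (S v) (?at v e2) (?at v e3)"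
        using False v(1) inc(1) inc' by blast+
      have at': "?at v e1 \<in> S v" "?at v e2 \<in> S v" "?at v e3 \<in> S v" "matched G (S v - {?at v e1})"
        "matched G (S v - {?at v e2})" "matched G (S v - {?at v e3})" using at by auto
      have "S v = {?at v e1, ?at v e2, ?at v e3} \<and> distinct [?at v e1, ?at v e2, ?at v e3] \<and>
          (\<exists>h\<in>edges G. ends G h = {?at v e1, ?at v e2}) \<and>
          (\<exists>h\<in>edges G. ends G h = {?at v e1, ?at v e3}) \<and>
          (\<exists>h\<in>edges G. ends G h = {?at v e2, ?at v e3})"
        by (rule shared_edge_or_triangle[OF G fin at']) (use v(2) nosh in blast)+
      then have t: "S v = {?at v e1, ?at v e2, ?at v e3}" "distinct [?at v e1, ?at v e2, ?at v e3]"
        "\<exists>h\<in>edges G. ends G h = {?at v e1, ?at v e2}" "\<exists>h\<in>edges G. ends G h = {?at v e1, ?at v e3}"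
        "\<exists>h\<in>edges G. ends G h = {?at v e2, ?at v e3}" by auto
      show "S v = ?at v ` {e \<in> edges J. v \<in> ends J e}" unfolding inc(1) using t(1) by simp
      show "inj_on (?at v) {e \<in> edges J. v \<in> ends J e}" unfolding inc(1) using t(2) by auto
      have "\<exists>h\<in>edges G. ends G h = {?at v x, ?at v y}"
        if "x \<in> {e1, e2, e3}" "y \<in> {e1, e2, e3}" "x \<noteq> y" for x y
        using that t(3-5) by (auto simp: insert_commute)
      then show "\<forall>e e'. e \<noteq> e' \<longrightarrow> e \<in> edges J \<longrightarrow> v \<in> ends J e \<longrightarrow> e' \<in> edges J \<longrightarrow>
        v \<in> ends J e' \<longrightarrow> (\<exists>h\<in>edges G. ends G h = {?at v e, ?at v e'})"
        using inc(1) by blast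
    qed
    have "conformal_minor (splice_K4 J T) G"
    proof (rule expansion_triangles_imp_minor[OF J(1) G ex])
      show "\<exists>x. S v = {x}" if "v \<in> verts J - T" for v using that unfolding T_def by blast
      show "\<exists>h\<in>edges G. ends G h = {?at v e, ?at v e'}"
        if "v \<in> T" "e \<noteq> e'" "e \<in> edges J" "v \<in> ends J e" "e' \<in> edges J" "v \<in> ends J e'" for v e e'
        using tri(3)[OF that(1)] that(2-) by blast
    qed (fact tri(1) tri(2) | simp add: T_def)+
    moreover have "T \<subseteq> verts J" by (simp add: T_def)
    ultimately show ?thesis by blast
  qed
qed

section \<open>The two shores of a cut\<close>

lemma boundary_complement:
  assumes G: "graph G" and "X \<subseteq> verts G"
  shows "boundary G (verts G - X) = boundary G X"
proof -
  have "card (ends G e \<inter> (verts G - X)) = 1 \<longleftrightarrow> card (ends G e \<inter> X) = 1" if "e \<in> edges G" for e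
  proof -
    have "ends G e \<inter> (verts G - X) = ends G e - ends G e \<inter> X"
      using ends_props(1)[OF G that] by blast
    then show ?thesis
      using card_Diff_subset[of "ends G e \<inter> X" "ends G e"] card_mono[of "ends G e" "ends G e \<inter> X"]
        ends_props(2,3)[OF G that] by auto
  qed
  then show ?thesis unfolding boundary_def by blast
qed

theorem theorem1p17:
  fixes J :: "('a, 'b) mgraph" and G :: "('v, 'e) mgraph" and C :: "'e set"
  assumes "graph J" and "two_connected J" and "cubic J"
    and "graph G" and "matching_covered G"
    and "separating_cut G C"
    and "minor_free (K4_family J) G"
  shows "\<forall>H \<in> cut_contractions G C. minor_free (K4_family J) H"
proof
  fix H assume "H \<in> cut_contractions G C"
  then obtain X where X: "X \<subseteq> verts G" "boundary G X = C" and H: "H = contract G X"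
    unfolding cut_contractions_def by blast
  \<comment> \<open>To lift minors from \<open>G/X\<close>, the opposite contraction must be
    matching covered, and it is a contraction of the same cut.\<close>
  have "contract G (verts G - X) \<in> cut_contractions G C"
    unfolding cut_contractions_def using boundary_complement[OF assms(4) X(1)] X(2) by blast
  then have mc: "matching_covered (contract G (verts G - X))"
    using assms(6) unfolding separating_cut_def by blast
  have incident: "\<exists>e\<in>edges J. v \<in> ends J e" if "v \<in> verts J" for v
  proof -
    have "card {e \<in> edges J. v \<in> ends J e} = 3"
      using assms(3) that by (simp add: cubic_def degree_def)
    then have "{e \<in> edges J. v \<in> ends J e} \<noteq> {}" by (metis card.empty zero_neq_numeral)
    then show ?thesis by blast
  qed
  have False if T: "T \<subseteq> verts J" and minor: "conformal_minor (splice_K4 J T) H" for T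
  proof -
    obtain S \<phi> where "expansion J G S \<phi>"
      using splice_minor_contract_imp_expansion[OF assms(4) X(1) mc assms(1,3) T] minor H by blast
    then obtain T' where "T' \<subseteq> verts J" "conformal_minor (splice_K4 J T') G"
      using expansion_imp_splice_minor[OF assms(1,3) incident assms(4)] by blast
    then show False using assms(7) unfolding minor_free_def K4_family_def by blast
  qed
  then show "minor_free (K4_family J) H" unfolding minor_free_def K4_family_def by blast
qed

end
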